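(* $\overline{k\mathrm{NN}}=k\mathrm{STAT}$ and $\overline{k\mathrm{HNN}}=k\mathrm{STAT}_{\mathrm{poly}}$.
   Context: All classes are classes of families of Boolean functions $f_n:\{0,1\}^n\to\{0,1\}$; "polynomial" means polynomial in $n$. Let $\Delta(\mathbf{x},\mathbf{y})=\|\mathbf{x}-\mathbf{y}\|_2^2$. A $k$-nearest neighbors representation of $f$ consists of disjoint finite sets $P,N\subseteq\mathbb{R}^n$ (anchors) and a positive integer $k$ such that $f(\mathbf{x})=1$ iff there exists $A\subseteq P\cup N$ with $|A|=k$, $|A\cap P|\ge|A\cap N|$, and $\Delta(\mathbf{x},\mathbf{a})<\Delta(\mathbf{x},\mathbf{b})$ for all $\mathbf{a}\in A$, $\mathbf{b}\notin A$; a Boolean one additionally has $P,N\subseteq\{0,1\}^n$. $k\mathrm{NN}$ (resp. $k\mathrm{HNN}$) is the class of functions having such representations (resp. Boolean ones) with polynomially many anchors, for some positive integer $k$. A substitution of variables $v:\{0,1\}^n\to\{0,1\}^{\tilde n}$ outputs a vector each of whose coordinates is some $x_i$ (duplication allowed) or a constant; $f$ is a subfunction of $g$ if $\tilde n=\mathrm{poly}(n)$ and $f=g\circ v$; $\overline{C}$ is the set of subfunctions of members of $C$. For a vector $\mathbf{z}$, $\mathbf{z}_{(k)}$ denotes its $k$-th smallest entry. $k\mathrm{STAT}$ is the class of functions $f$ for which there exist linear forms (affine functions) with integer coefficients $L_1,\dots,L_{\ell_1},R_1,\dots,R_{\ell_2}$ with $\ell_1+\ell_2$ polynomial in $n$,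 and integers $k_l,k_r$, such that $f(\mathbf{x})=1\iff(L_1(\mathbf{x}),\dots,L_{\ell_1}(\mathbf{x}))_{(k_l)}<(R_1(\mathbf{x}),\dots,R_{\ell_2}(\mathbf{x}))_{(k_r)}$. $k\mathrm{STAT}_{\mathrm{poly}}$ is the subclass where all coefficients are bounded in absolute value by a polynomial in $n$. *)

theory Defs
  imports
    "Jordan_Normal_Form.Matrix"
    "HOL-Computational_Algebra.Polynomial"
begin

text \<open>
  A family \<open>(f\<^sub>n)\<close> of functions \<open>{0,1}\<^sup>n \<rightarrow> {0,1}\<close>, one for every \<open>n\<close>, is the same thing
  as a single function on Boolean vectors of arbitrary dimension: \<open>f\<^sub>n\<close> is the restriction of
  \<open>f\<close> to \<^term>\<open>carrier_vec n\<close>. With this encoding equality of classes of families is plain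
  equality of sets.
\<close>

type_synonym bool_family = "bool vec \<Rightarrow> bool"

definition poly_bounded :: "(nat \<Rightarrow> nat) \<Rightarrow> bool" where
  "poly_bounded s \<longleftrightarrow> (\<exists>p :: nat poly. \<forall>n. s n \<le> poly p n)"

abbreviation embed :: "bool vec \<Rightarrow> 'a :: zero_neq_one vec" where
  "embed x \<equiv> map_vec of_bool x"

definition hypercube :: "nat \<Rightarrow> real vec set" where
  "hypercube n = embed ` carrier_vec n"

definition sq_dist :: "real vec \<Rightarrow> real vec \<Rightarrow> real" where
  "sq_dist x y = (x - y) \<bullet> (x - y)"


text \<open>
  If the \<open>k\<close> nearest anchors of \<open>x\<close> are not uniquely determined (ties, or fewer than \<open>k\<close>
  anchors), then no suitable \<open>A\<close> exists and the represented value is 0.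
\<close>

definition knn_rep ::
  "nat \<Rightarrow> nat \<Rightarrow> real vec set \<Rightarrow> real vec set \<Rightarrow> bool_family \<Rightarrow> bool" where
  "knn_rep n k P N f \<longleftrightarrow>
     finite P \<and> finite N \<and> P \<inter> N = {} \<and> P \<subseteq> carrier_vec n \<and> N \<subseteq> carrier_vec n \<and> k > 0 \<and>
     (\<forall>x \<in> carrier_vec n. f x \<longleftrightarrow>
        (\<exists>A \<subseteq> P \<union> N. card A = k \<and> card (A \<inter> P) \<ge> card (A \<inter> N) \<and>
           (\<forall>a \<in> A. \<forall>b \<in> (P \<union> N) - A. sq_dist (embed x) a < sq_dist (embed x) b)))"

text \<open>The number \<open>k\<close> of neighbours may depend on \<open>n\<close>.\<close>

definition kNN :: "bool_family set" where
  "kNN = {f. \<exists>s. poly_bounded s \<and>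
     (\<forall>n. \<exists>k P N. knn_rep n k P N f \<and> card (P \<union> N) \<le> s n)}"

definition kHNN :: "bool_family set" where
  "kHNN = {f. \<exists>s. poly_bounded s \<and>
     (\<forall>n. \<exists>k P N. knn_rep n k P N f \<and> P \<subseteq> hypercube n \<and> N \<subseteq> hypercube n \<and>
        card (P \<union> N) \<le> s n)}"


definition substitution :: "nat \<Rightarrow> nat \<Rightarrow> (bool vec \<Rightarrow> bool vec) \<Rightarrow> bool" where
  "substitution n m v \<longleftrightarrow>
     (\<forall>x \<in> carrier_vec n. v x \<in> carrier_vec m) \<and>
     (\<forall>j < m. (\<exists>i < n. \<forall>x \<in> carrier_vec n. v x $ j = x $ i) \<or>
              (\<exists>c. \<forall>x \<in> carrier_vec n. v x $ j = c))"

definition subfunction :: "bool_family \<Rightarrow> bool_family \<Rightarrow> bool" where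
  "subfunction f g \<longleftrightarrow>
     (\<exists>m v. poly_bounded m \<and>
        (\<forall>n. substitution n (m n) (v n) \<and> (\<forall>x \<in> carrier_vec n. f x = g (v n x))))"

definition subfunctions :: "bool_family set \<Rightarrow> bool_family set" where
  "subfunctions C = {f. \<exists>g \<in> C. subfunction f g}"


text \<open>The pair \<open>(a, b)\<close> stands for the affine function \<open>x \<mapsto> a \<bullet> x + b\<close>.\<close>

type_synonym linear_form = "int vec \<times> int"

definition eval_form :: "linear_form \<Rightarrow> bool vec \<Rightarrow> int" where
  "eval_form L x = fst L \<bullet> embed x + snd L"

text \<open>Entries are counted from 1, so this is meaningful for \<open>1 \<le> k \<le> length zs\<close>.\<close>

definition kth_smallest :: "nat \<Rightarrow> int list \<Rightarrow> int" where
  "kth_smallest k zs = sort zs ! (k - 1)"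

definition kstat_rep ::
  "nat \<Rightarrow> linear_form list \<Rightarrow> linear_form list \<Rightarrow> nat \<Rightarrow> nat \<Rightarrow> bool_family \<Rightarrow> bool" where
  "kstat_rep n Ls Rs kl kr f \<longleftrightarrow>
     (\<forall>L \<in> set Ls \<union> set Rs. fst L \<in> carrier_vec n) \<and>
     1 \<le> kl \<and> kl \<le> length Ls \<and> 1 \<le> kr \<and> kr \<le> length Rs \<and>
     (\<forall>x \<in> carrier_vec n. f x \<longleftrightarrow>
        kth_smallest kl (map (\<lambda>L. eval_form L x) Ls) <
        kth_smallest kr (map (\<lambda>R. eval_form R x) Rs))"

definition coeffs_bounded :: "nat \<Rightarrow> linear_form \<Rightarrow> bool" where
  "coeffs_bounded c L \<longleftrightarrow>
     (\<forall>i < dim_vec (fst L). \<bar>fst L $ i\<bar> \<le> int c) \<and> \<bar>snd L\<bar> \<le> int c"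

definition kSTAT :: "bool_family set" where
  "kSTAT = {f. \<exists>s. poly_bounded s \<and>
     (\<forall>n. \<exists>Ls Rs kl kr. kstat_rep n Ls Rs kl kr f \<and> length Ls + length Rs \<le> s n)}"

definition kSTAT_poly :: "bool_family set" where
  "kSTAT_poly = {f. \<exists>s c. poly_bounded s \<and> poly_bounded c \<and>
     (\<forall>n. \<exists>Ls Rs kl kr. kstat_rep n Ls Rs kl kr f \<and> length Ls + length Rs \<le> s n \<and>
        (\<forall>L \<in> set Ls \<union> set Rs. coeffs_bounded (c n) L))}"

end

(*
  On the cube the squared distance to an anchor is an affine function of x, and conversely every
  affine function is, up to a common additive constant and a positive factor, such a distance.

  From neighbours to order statistics: "exactly k anchors lie within radius r, and at least
  ceil(k/2) of them are in P" is equivalent to "the weighted number of anchors within radius r is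
  at least k*k + ceil(k/2), and their unweighted number is at most k", where P has weight k + 1 and
  N has weight k. This is a comparison of two order statistics, and it treats ties correctly. Real
  coefficients are scaled and rounded up on the left and down on the right.

  From order statistics to neighbours: padding with small constants makes both ranks equal to some
  t, and a perturbation breaks all ties without changing comparisons between the two sides. For
  k = 2*t - 1 the left side then wins the vote exactly if its t-th value is the smaller one. Extra
  coordinates, set to 0 by the substitution, correct the constant terms of the distances; with
  Boolean anchors the coefficients are produced by duplicating variables.
*)
theory Submission
  imports Defs
begin

subsection \<open>Order statistics\<close>

text \<open>The entries at most \<theta> form an initial segment of the sorted list, so position
  \<open>k - 1\<close> lies in it exactly if its length is at least \<open>k\<close>.\<close>

lemma kth_smallest_le_iff:
  assumes "1 \<le> k" "k \<le> length zs"
  shows "kth_smallest k zs \<le> \<theta> \<longleftrightarrow> k \<le> length (filter (\<lambda>z. z \<le> \<theta>) zs)"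
proof -
  let ?ys = "sort zs"
  have "length (filter (\<lambda>z. z \<le> \<theta>) zs) = length (filter (\<lambda>z. z \<le> \<theta>) ?ys)"
    by (simp add: filter_sort)
  then have len: "length (filter (\<lambda>z. z \<le> \<theta>) zs) = card {i. i < length ?ys \<and> ?ys ! i \<le> \<theta>}"
    by (simp only: length_filter_conv_card)
  show ?thesis
  proof
    assume le: "kth_smallest k zs \<le> \<theta>"
    have "?ys ! i \<le> \<theta>" if "i < k" for i
    proof -
      have "?ys ! i \<le> ?ys ! (k - 1)"
        using that assms by (intro sorted_nth_mono) auto
      with le show ?thesis by (simp add: kth_smallest_def)
    qed
    then have "{..<k} \<subseteq> {i. i < length ?ys \<and> ?ys ! i \<le> \<theta>}"
      using assms by auto
    then have "card {..<k} \<le> card {i. i < length ?ys \<and> ?ys ! i \<le> \<theta>}"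
      by (intro card_mono) auto
    then show "k \<le> length (filter (\<lambda>z. z \<le> \<theta>) zs)" by (simp add: len)
  next
    assume k: "k \<le> length (filter (\<lambda>z. z \<le> \<theta>) zs)"
    show "kth_smallest k zs \<le> \<theta>"
    proof (rule ccontr)
      assume "\<not> kth_smallest k zs \<le> \<theta>"
      then have gt: "?ys ! (k - 1) > \<theta>" by (simp add: kth_smallest_def)
      have "i < k - 1" if "i < length ?ys" "?ys ! i \<le> \<theta>" for i
      proof (rule ccontr)
        assume "\<not> i < k - 1"
        then have "?ys ! (k - 1) \<le> ?ys ! i" using that by (intro sorted_nth_mono) auto
        with gt that show False by simp
      qed
      then have "{i. i < length ?ys \<and> ?ys ! i \<le> \<theta>} \<subseteq> {..<k - 1}" by auto
      then have "card {i. i < length ?ys \<and> ?ys ! i \<le> \<theta>} \<le> card {..<k - 1}"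
        by (intro card_mono) auto
      with k assms show False by (simp add: len)
    qed
  qed
qed

text \<open>The left order statistic itself serves as the threshold \<theta>. Later arguments work
  with such counts instead of sorted lists.\<close>

lemma kth_smallest_less_iff:
  assumes "1 \<le> kl" "kl \<le> length ls" "1 \<le> kr" "kr \<le> length rs"
  shows "kth_smallest kl ls < kth_smallest kr rs \<longleftrightarrow>
    (\<exists>\<theta>. kl \<le> length (filter (\<lambda>z. z \<le> \<theta>) ls) \<and> length (filter (\<lambda>z. z \<le> \<theta>) rs) < kr)"
proof -
  have "kth_smallest kl ls < kth_smallest kr rs \<longleftrightarrow>
      (\<exists>\<theta>. kth_smallest kl ls \<le> \<theta> \<and> \<not> kth_smallest kr rs \<le> \<theta>)"
    by force
  then show ?thesis
    unfolding kth_smallest_le_iff[OF assms(1,2)] kth_smallest_le_iff[OF assms(3,4)] not_le .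
qed

text \<open>Only the comparisons \<open>u i < w j\<close> across the two sides matter, so ties within a side may be
  broken freely.\<close>

lemma order_statistic_transfer:
  fixes u w :: "'i \<Rightarrow> 'a :: linorder" and u' w' :: "'i \<Rightarrow> 'b :: linorder"
  assumes fin: "finite I" "finite J" and kl: "1 \<le> kl"
    and iff: "\<And>i j. i \<in> I \<Longrightarrow> j \<in> J \<Longrightarrow> u i < w j \<longleftrightarrow> u' i < w' j"
    and \<theta>: "kl \<le> card {i \<in> I. u i \<le> \<theta>}" "card {j \<in> J. w j \<le> \<theta>} < kr"
  shows "\<exists>\<theta>'. kl \<le> card {i \<in> I. u' i \<le> \<theta>'} \<and> card {j \<in> J. w' j \<le> \<theta>'} < kr"
proof -
  let ?X = "{i \<in> I. u i \<le> \<theta>}"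
  have "?X \<noteq> {}" using \<theta>(1) kl by force
  then have Max: "Max (u' ` ?X) \<in> u' ` ?X" using fin by (intro Max_in) auto
  then obtain i0 where i0: "i0 \<in> ?X" "Max (u' ` ?X) = u' i0" by auto
  have "u' i \<le> u' i0" if "i \<in> ?X" for i
    unfolding i0(2)[symmetric] using that fin by (intro Max_ge) auto
  then have "?X \<subseteq> {i \<in> I. u' i \<le> u' i0}" by auto
  then have "card ?X \<le> card {i \<in> I. u' i \<le> u' i0}" using fin by (intro card_mono) auto
  \<comment> \<open>If \<open>w' j \<le> u' i0\<close>, then \<open>u i0 < w j\<close> fails by the
    assumed equivalence, hence \<open>w j \<le> u i0 \<le> \<theta>\<close>.\<close>
  moreover have "{j \<in> J. w' j \<le> u' i0} \<subseteq> {j \<in> J. w j \<le> \<theta>}"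
    using i0(1) iff by (auto simp: not_less[symmetric]) (meson dual_order.strict_trans1 not_less)+
  then have "card {j \<in> J. w' j \<le> u' i0} \<le> card {j \<in> J. w j \<le> \<theta>}"
    using fin by (intro card_mono) auto
  ultimately show ?thesis using \<theta> by (meson le_trans le_less_trans)
qed

lemma order_statistic_cong:
  fixes u w :: "'i \<Rightarrow> 'a :: linorder" and u' w' :: "'i \<Rightarrow> 'b :: linorder"
  assumes "finite I" "finite J" "1 \<le> kl"
    and "\<And>i j. i \<in> I \<Longrightarrow> j \<in> J \<Longrightarrow> u i < w j \<longleftrightarrow> u' i < w' j"
  shows "(\<exists>\<theta>. kl \<le> card {i \<in> I. u i \<le> \<theta>} \<and> card {j \<in> J. w j \<le> \<theta>} < kr) \<longleftrightarrow>
    (\<exists>\<theta>. kl \<le> card {i \<in> I. u' i \<le> \<theta>} \<and> card {j \<in> J. w' j \<le> \<theta>} < kr)"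
  using order_statistic_transfer[of I J kl u w u' w'] order_statistic_transfer[of I J kl u' w' u w]
    assms by meson

subsection \<open>Polynomial bounds and linear forms\<close>

text \<open>Coefficients in \<open>nat\<close> cannot be negative. Monotonicity makes polynomial
  bounds composable and later makes the padded dimensions strictly increasing.\<close>

lemma poly_nat_mono:
  fixes p :: "nat poly"
  assumes "a \<le> b"
  shows "poly p a \<le> poly p b"
  by (induction p) (auto intro!: add_mono mult_mono assms)

lemma poly_bounded_const: "poly_bounded (\<lambda>_. c)"
  unfolding poly_bounded_def by (rule exI[of _ "[:c:]"]) simp

lemma poly_bounded_id: "poly_bounded (\<lambda>n. n)"
  unfolding poly_bounded_def by (rule exI[of _ "[:0, 1:]"]) simp

lemma poly_bounded_poly: "poly_bounded (poly p)"
  unfolding poly_bounded_def by blast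

lemma poly_bounded_add:
  assumes "poly_bounded s" "poly_bounded t"
  shows "poly_bounded (\<lambda>n. s n + t n)"
proof -
  from assms obtain p q where "\<And>n. s n \<le> poly p n" "\<And>n. t n \<le> poly q n"
    unfolding poly_bounded_def by blast
  then show ?thesis
    unfolding poly_bounded_def by (intro exI[of _ "p + q"]) (simp add: add_mono)
qed

lemma poly_bounded_mult:
  assumes "poly_bounded s" "poly_bounded t"
  shows "poly_bounded (\<lambda>n. s n * t n)"
proof -
  from assms obtain p q where "\<And>n. s n \<le> poly p n" "\<And>n. t n \<le> poly q n"
    unfolding poly_bounded_def by blast
  then show ?thesis
    unfolding poly_bounded_def by (intro exI[of _ "p * q"]) (simp add: mult_mono)
qed

lemma poly_bounded_compose:
  assumes "poly_bounded s" "poly_bounded m"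
  shows "poly_bounded (\<lambda>n. s (m n))"
proof -
  from assms obtain p q where s: "\<And>n. s n \<le> poly p n" and m: "\<And>n. m n \<le> poly q n"
    unfolding poly_bounded_def by blast
  have "s (m n) \<le> poly (pcompose p q) n" for n
    using s[of "m n"] poly_nat_mono[OF m[of n], of p] by (simp add: poly_pcompose)
  then show ?thesis unfolding poly_bounded_def by blast
qed

lemmas poly_bounded_intros =
  poly_bounded_const poly_bounded_id poly_bounded_poly poly_bounded_add poly_bounded_mult

lemma coeffs_bounded_mono: "coeffs_bounded c L \<Longrightarrow> c \<le> d \<Longrightarrow> coeffs_bounded d L"
  unfolding coeffs_bounded_def by fastforce

lemma eval_form_sum:
  assumes "fst L \<in> carrier_vec n" "x \<in> carrier_vec n"
  shows "eval_form L x = (\<Sum>i<n. fst L $ i * of_bool (x $ i)) + snd L"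
  using assms by (simp add: eval_form_def scalar_prod_def atLeast0LessThan)

lemma eval_form_zero: "x \<in> carrier_vec n \<Longrightarrow> eval_form (0\<^sub>v n, b) x = b"
  by (simp add: eval_form_sum[where n = n])

lemma abs_eval_form_le:
  assumes "fst L \<in> carrier_vec n" "x \<in> carrier_vec n" "coeffs_bounded c L"
  shows "\<bar>eval_form L x\<bar> \<le> int ((n + 1) * c)"
proof -
  have "\<bar>\<Sum>i<n. fst L $ i * of_bool (x $ i)\<bar> \<le> (\<Sum>i<n. int c)"
    using assms by (intro order_trans[OF sum_abs] sum_mono) (auto simp: coeffs_bounded_def)
  then show ?thesis
    using assms(3) by (auto simp: eval_form_sum[OF assms(1,2)] coeffs_bounded_def algebra_simps)
qed

lemma sq_dist_sum:
  assumes "y \<in> carrier_vec m" "a \<in> carrier_vec m"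
  shows "sq_dist (embed y) a = (\<Sum>j<m. (of_bool (y $ j) - a $ j)\<^sup>2)"
  using assms by (simp add: sq_dist_def scalar_prod_def atLeast0LessThan power2_eq_square)

lemma finite_carrier_vec_bool: "finite (carrier_vec n :: bool vec set)"
proof -
  have "carrier_vec n \<subseteq> vec_of_list ` {xs :: bool list. length xs = n}"
    by (auto intro!: image_eqI[where x = "list_of_vec _"] simp: vec_list)
  moreover have "finite {xs :: bool list. length xs = n}"
    using finite_lists_length_eq[of "UNIV :: bool set" n] by simp
  ultimately show ?thesis using finite_surj by blast
qed

lemma length_filter_map_distinct:
  "distinct xs \<Longrightarrow> length (filter p (map g xs)) = card {a \<in> set xs. p (g a)}"
  by (simp add: filter_map comp_def flip: distinct_card)

lemma length_filter_concat_replicate: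
  "length (filter p (concat (replicate m xs))) = m * length (filter p xs)"
  by (induction m) auto

lemma length_concat_replicate: "length (concat (replicate m xs)) = m * length xs"
  by (induction m) auto

subsection \<open>From nearest neighbors to order statistics\<close>

text \<open>Separating the value at a point from the represented family allows evaluation at a
  substituted point \<open>v x\<close>, possibly of another dimension than \<open>x\<close>.\<close>

definition knn_value :: "nat \<Rightarrow> real vec set \<Rightarrow> real vec set \<Rightarrow> bool vec \<Rightarrow> bool" where
  "knn_value k P N y \<longleftrightarrow>
     (\<exists>A \<subseteq> P \<union> N. card A = k \<and> card (A \<inter> P) \<ge> card (A \<inter> N) \<and>
        (\<forall>a \<in> A. \<forall>b \<in> (P \<union> N) - A. sq_dist (embed y) a < sq_dist (embed y) b))"

lemma knn_rep_iff:
  "knn_rep n k P N f \<longleftrightarrow>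
     finite P \<and> finite N \<and> P \<inter> N = {} \<and> P \<union> N \<subseteq> carrier_vec n \<and> k > 0 \<and>
     (\<forall>x \<in> carrier_vec n. f x \<longleftrightarrow> knn_value k P N x)"
  by (auto simp: knn_rep_def knn_value_def)

text \<open>Giving the elements of \<open>P\<close> weight \<open>k + 1\<close> and those of \<open>N\<close> weight \<open>k\<close> turns the two
  conditions ``\<open>k\<close> neighbours'' and ``majority in \<open>P\<close>'' into a single threshold condition.
  Bounding the number of all elements below \<open>\<theta>\<close> by \<open>k\<close> excludes ties.\<close>

lemma separated_majority_iff:
  fixes hi lo :: "'a \<Rightarrow> 'b :: linorder"
  assumes fin: "finite P" "finite N" and disj: "P \<inter> N = {}" and k: "k > 0"
    and lohi: "\<And>a. a \<in> P \<union> N \<Longrightarrow> lo a \<le> hi a"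
    and B: "\<And>a. a \<in> P \<union> N \<Longrightarrow> hi a < B"
  shows "(\<exists>A \<subseteq> P \<union> N. card A = k \<and> card (A \<inter> P) \<ge> card (A \<inter> N) \<and>
        (\<forall>a \<in> A. \<forall>b \<in> (P \<union> N) - A. hi a < lo b)) \<longleftrightarrow>
    (\<exists>\<theta><B. k * k + (k + 1) div 2 \<le> k * card {a \<in> P \<union> N. hi a \<le> \<theta>} + card {a \<in> P. hi a \<le> \<theta>} \<and>
        card {a \<in> P \<union> N. lo a \<le> \<theta>} \<le> k)" (is "?l \<longleftrightarrow> ?r")
proof
  assume ?l
  then obtain A where A: "A \<subseteq> P \<union> N" "card A = k" "card (A \<inter> P) \<ge> card (A \<inter> N)"
    and sep: "\<And>a b. a \<in> A \<Longrightarrow> b \<in> (P \<union> N) - A \<Longrightarrow> hi a < lo b" by blast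
  have finA: "finite A" and "A \<noteq> {}" using A fin k by (auto intro: finite_subset)
  then have "Max (hi ` A) \<in> hi ` A" by (intro Max_in) auto
  then obtain a0 where a0: "a0 \<in> A" "Max (hi ` A) = hi a0" by auto
  have le: "hi a \<le> hi a0" if "a \<in> A" for a
    unfolding a0(2)[symmetric] using that finA by (intro Max_ge) auto
  have "card A = card (A \<inter> P \<union> A \<inter> N)" using A(1) by (intro arg_cong[where f = card]) auto
  also have "\<dots> = card (A \<inter> P) + card (A \<inter> N)"
    using finA disj by (intro card_Un_disjoint) auto
  finally have half: "(k + 1) div 2 \<le> card (A \<inter> P)" using A by linarith
  have "card A \<le> card {a \<in> P \<union> N. hi a \<le> hi a0}"
    using fin A(1) le by (intro card_mono) auto
  then have 1: "k * k \<le> k * card {a \<in> P \<union> N. hi a \<le> hi a0}" using A(2) by simp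
  have 2: "card (A \<inter> P) \<le> card {a \<in> P. hi a \<le> hi a0}"
    using fin le by (intro card_mono) auto
  have "{a \<in> P \<union> N. lo a \<le> hi a0} \<subseteq> A" using sep[OF a0(1)] by fastforce
  then have 3: "card {a \<in> P \<union> N. lo a \<le> hi a0} \<le> k" using card_mono[OF finA] A(2) by blast
  have "hi a0 < B" using a0(1) A(1) B by blast
  moreover have "k * k + (k + 1) div 2 \<le>
      k * card {a \<in> P \<union> N. hi a \<le> hi a0} + card {a \<in> P. hi a \<le> hi a0}"
    using 1 2 half by linarith
  ultimately show ?r using 3 by blast
next
  assume ?r
  then obtain \<theta> where ge: "k * k + (k + 1) div 2 \<le>
      k * card {a \<in> P \<union> N. hi a \<le> \<theta>} + card {a \<in> P. hi a \<le> \<theta>}"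
    and le: "card {a \<in> P \<union> N. lo a \<le> \<theta>} \<le> k" by blast
  let ?H = "{a \<in> P \<union> N. hi a \<le> \<theta>}" and ?B = "{a \<in> P \<union> N. lo a \<le> \<theta>}"
  have sub: "?H \<subseteq> ?B" using lohi order_trans by blast
  have "card ?H \<le> card ?B" using fin sub by (intro card_mono) auto
  moreover have HP: "card {a \<in> P. hi a \<le> \<theta>} \<le> card ?H" using fin by (intro card_mono) auto
  \<comment> \<open>With at most \<open>k - 1\<close> elements counted, the weighted count is at
    most \<open>(k + 1) * (k - 1) < k * k\<close>, too small for the threshold.\<close>
  moreover have "\<not> card ?H \<le> k - 1"
  proof
    assume *: "card ?H \<le> k - 1"
    then have "k * card ?H \<le> k * (k - 1)" by simp
    also have "\<dots> + k = k * k" using k by (cases k) auto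
    finally have "k * card ?H + card {a \<in> P. hi a \<le> \<theta>} < k * k" using HP * k by linarith
    with ge show False by linarith
  qed
  ultimately have cardH: "card ?H = k" using le by linarith
  \<comment> \<open>Both counts are now exactly \<open>k\<close>, so no element has
    \<open>lo\<close> at most \<theta> but \<open>hi\<close> above it: \<theta> separates
    \<open>?H\<close> from the rest.\<close>
  have eq: "?H = ?B" using sub le cardH fin by (intro card_seteq) auto
  have "card ?H = card (?H \<inter> P \<union> ?H \<inter> N)" by (intro arg_cong[where f = card]) auto
  also have "\<dots> = card (?H \<inter> P) + card (?H \<inter> N)"
    using fin disj by (intro card_Un_disjoint) auto
  also have "?H \<inter> P = {a \<in> P. hi a \<le> \<theta>}" by auto
  finally have "card {a \<in> P. hi a \<le> \<theta>} + card (?H \<inter> N) = k" using cardH by simp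
  moreover have "(k + 1) div 2 \<le> card {a \<in> P. hi a \<le> \<theta>}" using ge cardH by simp
  ultimately have "card (?H \<inter> N) \<le> card {a \<in> P. hi a \<le> \<theta>}" by linarith
  moreover have "?H \<inter> P = {a \<in> P. hi a \<le> \<theta>}" by auto
  moreover have "hi a < lo b" if "a \<in> ?H" "b \<in> (P \<union> N) - ?H" for a b
  proof -
    have "hi a \<le> \<theta>" using that by blast
    moreover have "\<theta> < lo b" using that(2) unfolding eq by auto
    ultimately show ?thesis by simp
  qed
  ultimately show ?l using cardH by (intro exI[of _ ?H]) auto
qed

text \<open>The comparison \<open>0 < 0\<close> never holds; this covers the degenerate case of
  fewer than \<open>k\<close> anchors.\<close>

lemma kstat_rep_False:
  assumes "\<And>x. x \<in> carrier_vec n \<Longrightarrow> \<not> f x"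
  shows "kstat_rep n [(0\<^sub>v n, 0)] [(0\<^sub>v n, 0)] 1 1 f"
  using assms by (auto simp: kstat_rep_def kth_smallest_def)

text \<open>Common core of the real and the Boolean case. Each anchor gets an upper form
  \<open>hi\<close> and a lower form \<open>lo\<close>, and only the comparisons
  \<open>hi a < lo b\<close> have to agree with the distances; the case \<open>a = b\<close> yields
  \<open>lo a \<le> hi a\<close>. The constant \<open>B\<close> serves as padding.\<close>

lemma knn_rep_imp_kstat_rep:
  assumes rep: "knn_rep n k P N f"
    and carrier: "\<And>a. a \<in> P \<union> N \<Longrightarrow> fst (hi a) \<in> carrier_vec n"
      "\<And>a. a \<in> P \<union> N \<Longrightarrow> fst (lo a) \<in> carrier_vec n"
    and cmp: "\<And>a b x. a \<in> P \<union> N \<Longrightarrow> b \<in> P \<union> N \<Longrightarrow> x \<in> carrier_vec n \<Longrightarrow>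
      eval_form (hi a) x < eval_form (lo b) x \<longleftrightarrow> sq_dist (embed x) a < sq_dist (embed x) b"
    and B: "\<And>a x. a \<in> P \<union> N \<Longrightarrow> x \<in> carrier_vec n \<Longrightarrow> eval_form (hi a) x < B"
    and s: "card (P \<union> N) \<le> s"
  shows "\<exists>Ls Rs kl kr. kstat_rep n Ls Rs kl kr f \<and> length Ls + length Rs \<le> 2 * s * s + 4 * s + 2 \<and>
    set Ls \<union> set Rs \<subseteq> hi ` (P \<union> N) \<union> lo ` (P \<union> N) \<union> {(0\<^sub>v n, B), (0\<^sub>v n, 0)}"
proof (cases "k \<le> card (P \<union> N)")
  case False
  have fin: "finite (P \<union> N)" using rep by (simp add: knn_rep_iff)
  have "\<not> f x" if "x \<in> carrier_vec n" for x
    using that rep False card_mono[OF fin] by (auto simp: knn_rep_iff knn_value_def)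
  then show ?thesis
    by (intro exI[of _ "[(0\<^sub>v n, 0)]"] exI[of _ "1::nat"] conjI kstat_rep_False) auto
next
  case k: True
  have fin: "finite P" "finite N" and disj: "P \<inter> N = {}" and k0: "k > 0"
    and f: "\<And>x. x \<in> carrier_vec n \<Longrightarrow> f x \<longleftrightarrow> knn_value k P N x"
    using rep by (auto simp: knn_rep_iff)
  from fin obtain ps ns where ps: "set ps = P" "distinct ps" and ns: "set ns = N" "distinct ns"
    by (meson finite_distinct_list)
  have dist: "distinct (ps @ ns)" using ps ns disj by auto
  let ?kl = "k * k + (k + 1) div 2"
  \<comment> \<open>\<open>k\<close> copies of all anchors and one further copy of \<open>P\<close>
    realise the weights. The padding with \<open>B\<close> makes both ranks admissible and adds
    nothing to counts at thresholds below \<open>B\<close>.\<close>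
  define Ls where "Ls = concat (replicate k (map hi (ps @ ns))) @ map hi ps @ replicate ?kl (0\<^sub>v n, B)"
  define Rs where "Rs = map lo (ps @ ns) @ replicate (k + 1) (0\<^sub>v n, B)"
  have lenS: "length (ps @ ns) = card (P \<union> N)" and lenP: "length ps = card P"
    using distinct_card[OF dist] distinct_card[OF ps(2)] ps ns by auto
  have set: "set Ls \<union> set Rs \<subseteq> hi ` (P \<union> N) \<union> lo ` (P \<union> N) \<union> {(0\<^sub>v n, B), (0\<^sub>v n, 0)}"
  proof -
    let ?G = "hi ` (P \<union> N) \<union> lo ` (P \<union> N) \<union> {(0\<^sub>v n, B), (0\<^sub>v n, 0)}"
    have 1: "set (replicate i (0\<^sub>v n, B)) \<subseteq> ?G" for i by auto
    have 2: "set (concat (replicate k (map hi (ps @ ns)))) \<subseteq> ?G"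
      using ps ns by auto
    have 3: "set (map lo (ps @ ns)) \<subseteq> ?G" "set (map hi ps) \<subseteq> ?G"
      using ps ns by auto
    show ?thesis unfolding Ls_def Rs_def set_append by (intro Un_least 1 2 3)
  qed
  have kstat: "kstat_rep n Ls Rs ?kl (k + 1) f"
    unfolding kstat_rep_def
  proof (intro conjI ballI)
    show "fst L \<in> carrier_vec n" if "L \<in> set Ls \<union> set Rs" for L
    proof -
      from that set have "L \<in> hi ` (P \<union> N) \<union> lo ` (P \<union> N) \<union> {(0\<^sub>v n, B), (0\<^sub>v n, 0)}"
        by (rule rev_subsetD)
      then consider "L \<in> hi ` (P \<union> N)" | "L \<in> lo ` (P \<union> N)" | "fst L = 0\<^sub>v n" by fastforce
      then show ?thesis by cases (use carrier in auto)
    qed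
    show le: "1 \<le> ?kl" "?kl \<le> length Ls" "1 \<le> k + 1" "k + 1 \<le> length Rs"
      using k0 by (auto simp: Ls_def Rs_def)
    fix x :: "bool vec" assume x: "x \<in> carrier_vec n"
    let ?hi = "\<lambda>a. eval_form (hi a) x" and ?lo = "\<lambda>a. eval_form (lo a) x"
    have cntL: "length (filter (\<lambda>z. z \<le> \<theta>) (map (\<lambda>L. eval_form L x) Ls)) =
        k * card {a \<in> P \<union> N. ?hi a \<le> \<theta>} + card {a \<in> P. ?hi a \<le> \<theta>} + (if B \<le> \<theta> then ?kl else 0)" for \<theta>
    proof -
      have "map (\<lambda>L. eval_form L x) Ls =
          concat (replicate k (map ?hi (ps @ ns))) @ map ?hi ps @ replicate ?kl B"
        by (simp add: Ls_def map_concat eval_form_zero[OF x] comp_def)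
      then show ?thesis
        using ps ns by (simp only: filter_append length_append length_filter_concat_replicate
          length_filter_map_distinct[OF dist] length_filter_map_distinct[OF ps(2)]) simp
    qed
    have cntR: "length (filter (\<lambda>z. z \<le> \<theta>) (map (\<lambda>L. eval_form L x) Rs)) =
        card {a \<in> P \<union> N. ?lo a \<le> \<theta>} + (if B \<le> \<theta> then k + 1 else 0)" for \<theta>
    proof -
      have "map (\<lambda>L. eval_form L x) Rs = map ?lo (ps @ ns) @ replicate (k + 1) B"
        by (simp add: Rs_def eval_form_zero[OF x] comp_def)
      then show ?thesis
        using ps ns by (simp only: filter_append length_append
          length_filter_map_distinct[OF dist]) simp
    qed
    have "kth_smallest ?kl (map (\<lambda>L. eval_form L x) Ls) < kth_smallest (k + 1) (map (\<lambda>R. eval_form R x) Rs)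
      \<longleftrightarrow> (\<exists>\<theta>. ?kl \<le> k * card {a \<in> P \<union> N. ?hi a \<le> \<theta>} + card {a \<in> P. ?hi a \<le> \<theta>} + (if B \<le> \<theta> then ?kl else 0) \<and>
          card {a \<in> P \<union> N. ?lo a \<le> \<theta>} + (if B \<le> \<theta> then k + 1 else 0) < k + 1)"
      using le by (subst kth_smallest_less_iff) (simp_all only: length_map cntL cntR)
    \<comment> \<open>A threshold \<theta> \<ge> B counts all \<open>k + 1\<close> padding entries
      on the right, so it never witnesses the inequality.\<close>
    also have "\<dots> \<longleftrightarrow> (\<exists>\<theta><B. ?kl \<le> k * card {a \<in> P \<union> N. ?hi a \<le> \<theta>} + card {a \<in> P. ?hi a \<le> \<theta>} \<and>
        card {a \<in> P \<union> N. ?lo a \<le> \<theta>} \<le> k)"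
      by (intro ex_cong1) auto
    also have "\<dots> \<longleftrightarrow> (\<exists>A \<subseteq> P \<union> N. card A = k \<and> card (A \<inter> P) \<ge> card (A \<inter> N) \<and>
        (\<forall>a \<in> A. \<forall>b \<in> (P \<union> N) - A. ?hi a < ?lo b))"
      using cmp[OF _ _ x] B[OF _ x]
      by (intro separated_majority_iff[symmetric] fin disj k0) (auto simp: not_less[symmetric])
    also have "\<dots> \<longleftrightarrow> knn_value k P N x"
      unfolding knn_value_def
      by (intro ex_cong1 conj_cong refl ball_cong cmp x) auto
    finally show "f x \<longleftrightarrow> kth_smallest ?kl (map (\<lambda>L. eval_form L x) Ls) <
        kth_smallest (k + 1) (map (\<lambda>R. eval_form R x) Rs)"
      using f[OF x] by simp
  qed
  have "card P \<le> s" using s card_mono[of "P \<union> N" P] fin by simp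
  moreover have "k \<le> s" using k s by simp
  moreover have "k * k \<le> s * s" "k * card (P \<union> N) \<le> s * s"
    using k s by (auto intro!: mult_mono)
  moreover have "length Ls = k * card (P \<union> N) + card P + ?kl"
    using lenS lenP by (simp add: Ls_def length_concat_replicate)
  moreover have "length Rs = card (P \<union> N) + (k + 1)"
    using lenS by (simp add: Rs_def)
  ultimately have "length Ls + length Rs \<le> 2 * s * s + 4 * s + 2" using s k0 by auto
  with kstat set show ?thesis by blast
qed

section \<open>Distances as integer linear forms\<close>

text \<open>On the cube, \<open>sq_dist x a = (\<Sum>i. (1 - 2 * a\<^sub>i) * x\<^sub>i) + (\<Sum>i. a\<^sub>i\<^sup>2)\<close> as \<open>x\<^sub>i\<^sup>2 = x\<^sub>i\<close>.\<close>

definition round_form :: "(real \<Rightarrow> int) \<Rightarrow> real \<Rightarrow> real vec \<Rightarrow> linear_form" where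
  "round_form r Q a = (vec (dim_vec a) (\<lambda>i. r (Q * (1 - 2 * a $ i))), r (Q * (\<Sum>i<dim_vec a. (a $ i)\<^sup>2)))"

lemma fst_round_form: "a \<in> carrier_vec n \<Longrightarrow> fst (round_form r Q a) \<in> carrier_vec n"
  by (simp add: round_form_def)

text \<open>Each of the \<open>n + 1\<close> roundings has its error between \<open>l\<close> and
  \<open>u\<close>. A coefficient whose variable is 0 contributes error 0, which also lies in that
  range since \<open>l \<le> 0 \<le> u\<close>.\<close>

lemma round_form_error:
  assumes x: "x \<in> carrier_vec n" and a: "a \<in> carrier_vec n"
    and r: "\<And>y. l \<le> of_int (r y) - y" "\<And>y. of_int (r y) - y \<le> u" and lu: "l \<le> 0" "0 \<le> u"
  shows "of_int (eval_form (round_form r Q a) x) - Q * sq_dist (embed x) a \<in>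
    {(n + 1) * l..(n + 1) * u}"
proof -
  let ?e = "\<lambda>y. real_of_int (r y) - y"
  have "Q * sq_dist (embed x) a =
      (\<Sum>i<n. Q * (1 - 2 * a $ i) * of_bool (x $ i)) + Q * (\<Sum>i<n. (a $ i)\<^sup>2)"
    unfolding sq_dist_sum[OF x a] sum_distrib_left sum.distrib[symmetric]
    by (intro sum.cong) (auto simp: power2_eq_square algebra_simps)
  moreover have "real_of_int (eval_form (round_form r Q a) x) =
      (\<Sum>i<n. of_int (r (Q * (1 - 2 * a $ i))) * of_bool (x $ i)) + of_int (r (Q * (\<Sum>i<n. (a $ i)\<^sup>2)))"
    using a by (simp add: eval_form_sum[OF fst_round_form[OF a] x]) (simp add: round_form_def)
  ultimately have eq: "of_int (eval_form (round_form r Q a) x) - Q * sq_dist (embed x) a =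
      (\<Sum>i<n. ?e (Q * (1 - 2 * a $ i)) * of_bool (x $ i)) + ?e (Q * (\<Sum>i<n. (a $ i)\<^sup>2))"
    by (simp add: left_diff_distrib sum_subtractf)
  have "(\<Sum>i<n. l) \<le> (\<Sum>i<n. ?e (Q * (1 - 2 * a $ i)) * of_bool (x $ i))"
    using r(1) lu by (intro sum_mono) auto
  moreover have "(\<Sum>i<n. ?e (Q * (1 - 2 * a $ i)) * of_bool (x $ i)) \<le> (\<Sum>i<n. u)"
    using r(2) lu by (intro sum_mono) auto
  ultimately show ?thesis
    unfolding eq using r(1)[of "Q * (\<Sum>i<n. (a $ i)\<^sup>2)"] r(2)[of "Q * (\<Sum>i<n. (a $ i)\<^sup>2)"]
    by (simp add: algebra_simps)
qed

text \<open>The positive elements of a finite set are bounded away from 0, so one factor lifts all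
  of them above \<open>C\<close>.\<close>

lemma ex_scale:
  fixes X :: "real set"
  assumes "finite X"
  shows "\<exists>Q>0. \<forall>g\<in>X. 0 < g \<longrightarrow> C < Q * g"
  using assms
proof (induction X)
  case empty
  show ?case by (intro exI[of _ 1]) auto
next
  case (insert h X)
  then obtain Q where Q: "Q > 0" "\<And>g. g \<in> X \<Longrightarrow> 0 < g \<Longrightarrow> C < Q * g" by blast
  let ?Q = "max Q ((\<bar>C\<bar> + 1) / h)"
  have "C < ?Q * g" if "g \<in> insert h X" "0 < g" for g
  proof (cases "g = h")
    case True
    have "C < (\<bar>C\<bar> + 1) / h * h" using that True by simp
    also have "\<dots> \<le> ?Q * g" unfolding True using that True by (intro mult_right_mono) auto
    finally show ?thesis .
  next
    case False
    then have "C < Q * g" using that Q by auto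
    also have "\<dots> \<le> ?Q * g" using that by (intro mult_right_mono) auto
    finally show ?thesis .
  qed
  then show ?case using Q(1) by (intro exI[of _ ?Q]) auto
qed

text \<open>Rounding up on one side and down on the other cannot create a strict inequality, and a large
  scaling factor \<open>Q\<close> preserves the existing ones; hence equalities need not be preserved.\<close>

lemma knn_rep_imp_kstat:
  assumes rep: "knn_rep n k P N f" and s: "card (P \<union> N) \<le> s"
  shows "\<exists>Ls Rs kl kr. kstat_rep n Ls Rs kl kr f \<and> length Ls + length Rs \<le> 2 * s * s + 4 * s + 2"
proof -
  let ?S = "P \<union> N" and ?C = "carrier_vec n :: bool vec set"
  let ?d = "\<lambda>a x. sq_dist (embed x) a"
  have fin: "finite ?S" and S: "?S \<subseteq> carrier_vec n" using rep by (auto simp: knn_rep_iff)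
  have "finite ((\<lambda>(a, b, x). ?d b x - ?d a x) ` (?S \<times> ?S \<times> ?C))"
    using fin finite_carrier_vec_bool by blast
  \<comment> \<open>A gap must survive two roundings, \<open>hi\<close> moving up and
    \<open>lo\<close> moving down by at most \<open>n + 1\<close> each. Finiteness of the cube makes
    one scale sufficient for all points.\<close>
  from ex_scale[OF this] obtain Q where "Q > 0"
    and "\<forall>g\<in>(\<lambda>(a, b, x). ?d b x - ?d a x) ` (?S \<times> ?S \<times> ?C). 0 < g \<longrightarrow> 2 * (real n + 1) < Q * g"
    by blast
  then have Q: "Q > 0" "\<And>a b x. a \<in> ?S \<Longrightarrow> b \<in> ?S \<Longrightarrow> x \<in> ?C \<Longrightarrow> ?d a x < ?d b x \<Longrightarrow>
      2 * (real n + 1) < Q * (?d b x - ?d a x)"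
    by (auto simp: image_iff)
  define hi where "hi = round_form ceiling Q"
  define lo where "lo = round_form floor Q"
  have hi: "real_of_int (eval_form (hi a) x) - Q * ?d a x \<in> {0..n + 1}"
    if "a \<in> ?S" "x \<in> ?C" for a x
  proof -
    have "a \<in> carrier_vec n" using that S by blast
    moreover have "0 \<le> of_int \<lceil>y\<rceil> - y" "of_int \<lceil>y\<rceil> - y \<le> 1" for y :: real by linarith+
    ultimately show ?thesis
      using round_form_error[OF that(2), of a 0 ceiling 1 Q] by (simp add: hi_def)
  qed
  have lo: "real_of_int (eval_form (lo a) x) - Q * ?d a x \<in> {- (real n + 1)..0}"
    if "a \<in> ?S" "x \<in> ?C" for a x
  proof -
    have "a \<in> carrier_vec n" using that S by blast
    moreover have "- 1 \<le> of_int \<lfloor>y\<rfloor> - y" "of_int \<lfloor>y\<rfloor> - y \<le> 0" for y :: real by linarith+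
    ultimately show ?thesis
      using round_form_error[OF that(2), of a "-1" floor 0 Q] by (simp add: lo_def)
  qed
  \<comment> \<open>The padding constant only has to exceed finitely many values; its size may be
    arbitrary, as \<open>kSTAT\<close> restricts only the number of forms.\<close>
  have "finite ((\<lambda>(a, x). eval_form (hi a) x) ` (?S \<times> ?C))"
    using fin finite_carrier_vec_bool by blast
  then have "bdd_above ((\<lambda>(a, x). eval_form (hi a) x) ` (?S \<times> ?C))" by simp
  then obtain B0 where "\<And>z. z \<in> (\<lambda>(a, x). eval_form (hi a) x) ` (?S \<times> ?C) \<Longrightarrow> z \<le> B0"
    unfolding bdd_above_def by blast
  then have "eval_form (hi a) x \<le> B0" if "a \<in> ?S" "x \<in> ?C" for a x using that by auto
  then have B: "eval_form (hi a) x < B0 + 1" if "a \<in> ?S" "x \<in> ?C" for a x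
    using that by fastforce
  have "\<exists>Ls Rs kl kr. kstat_rep n Ls Rs kl kr f \<and> length Ls + length Rs \<le> 2 * s * s + 4 * s + 2 \<and>
    set Ls \<union> set Rs \<subseteq> hi ` ?S \<union> lo ` ?S \<union> {(0\<^sub>v n, B0 + 1), (0\<^sub>v n, 0)}"
  proof (rule knn_rep_imp_kstat_rep[OF rep _ _ _ B s])
    show "fst (hi a) \<in> carrier_vec n" "fst (lo a) \<in> carrier_vec n" if "a \<in> ?S" for a
      using that S by (auto simp: hi_def lo_def intro!: fst_round_form)
    fix a b x assume *: "a \<in> ?S" "b \<in> ?S" "x \<in> ?C"
    show "eval_form (hi a) x < eval_form (lo b) x \<longleftrightarrow> ?d a x < ?d b x"
    proof
      assume "eval_form (hi a) x < eval_form (lo b) x"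
      then have "real_of_int (eval_form (hi a) x) < real_of_int (eval_form (lo b) x)" by simp
      then have "Q * ?d a x < Q * ?d b x" using hi[OF *(1,3)] lo[OF *(2,3)] by auto
      then show "?d a x < ?d b x" using Q(1) by simp
    next
      assume "?d a x < ?d b x"
      then have "2 * (real n + 1) < Q * ?d b x - Q * ?d a x"
        using Q(2)[OF *] by (simp add: right_diff_distrib)
      then have "real_of_int (eval_form (hi a) x) < real_of_int (eval_form (lo b) x)"
        using hi[OF *(1,3)] lo[OF *(2,3)] by auto
      then show "eval_form (hi a) x < eval_form (lo b) x" by simp
    qed
  qed
  then show ?thesis by blast
qed

lemma hypercube_carrier: "hypercube n \<subseteq> carrier_vec n"
  by (auto simp: hypercube_def)

lemma hypercube_iff:
  "a \<in> hypercube n \<longleftrightarrow> a \<in> carrier_vec n \<and> (\<forall>i<n. a $ i \<in> {0, 1})"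
proof
  assume "a \<in> carrier_vec n \<and> (\<forall>i<n. a $ i \<in> {0, 1})"
  then have "a = embed (vec n (\<lambda>i. a $ i = 1))" by (intro eq_vecI) auto
  then show "a \<in> hypercube n" unfolding hypercube_def by (metis image_eqI vec_carrier)
qed (auto simp: hypercube_def)

text \<open>For 0/1 anchors scale 1 is already exact: the coefficients are 1 or -1, the constant
  term counts the ones of the anchor, and distances are at most \<open>n\<close>. So one form serves
  as both \<open>hi\<close> and \<open>lo\<close>, and \<open>n + 1\<close> as the padding
  constant.\<close>

lemma knn_rep_imp_kstat_poly:
  assumes rep: "knn_rep n k P N f" and s: "card (P \<union> N) \<le> s" and S: "P \<union> N \<subseteq> hypercube n"
  shows "\<exists>Ls Rs kl kr. kstat_rep n Ls Rs kl kr f \<and> length Ls + length Rs \<le> 2 * s * s + 4 * s + 2 \<and>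
    (\<forall>L \<in> set Ls \<union> set Rs. coeffs_bounded (n + 1) L)"
proof -
  let ?S = "P \<union> N" and ?C = "carrier_vec n :: bool vec set"
  let ?d = "\<lambda>a x. sq_dist (embed x) a"
  have *: "fst (round_form floor 1 a) \<in> carrier_vec n \<and> coeffs_bounded (n + 1) (round_form floor 1 a) \<and>
    (\<forall>x\<in>?C. real_of_int (eval_form (round_form floor 1 a) x) = ?d a x \<and> ?d a x \<le> n)"
    if a: "a \<in> hypercube n" for a
  proof (intro conjI ballI)
    have carr: "a \<in> carrier_vec n" and a01: "\<And>i. i < n \<Longrightarrow> a $ i = 0 \<or> a $ i = 1"
      using a by (auto simp: hypercube_iff)
    show "fst (round_form floor 1 a) \<in> carrier_vec n" by (rule fst_round_form[OF carr])
    have sq: "(\<Sum>i<n. (a $ i)\<^sup>2) = of_int (\<Sum>i<n. of_bool (a $ i = 1))"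
      unfolding of_int_sum by (intro sum.cong refl) (auto dest!: a01)
    have le: "(\<Sum>i<n. of_bool (a $ i = 1)) \<le> int n"
      using sum_bounded_above[of "{..<n}" "\<lambda>i. of_bool (a $ i = 1)" "1 :: int"] by auto
    have fst: "fst (round_form floor 1 a) $ i = (if a $ i = 1 then -1 else 1)" if "i < n" for i
      using carr a01[OF that] that floor_of_int[of "- 1", where 'a = real] by (auto simp: round_form_def)
    have snd: "snd (round_form floor 1 a) = (\<Sum>i<n. of_bool (a $ i = 1))"
      using carr sq by (simp add: round_form_def flip: of_int_sum)
    show "coeffs_bounded (n + 1) (round_form floor 1 a)"
      unfolding coeffs_bounded_def snd
    proof (intro conjI allI impI)
      fix i assume "i < dim_vec (fst (round_form floor 1 a))"
      then have "i < n" using fst_round_form[OF carr, of floor 1] by simp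
      then show "\<bar>fst (round_form floor 1 a) $ i\<bar> \<le> int (n + 1)" using fst by simp
    next
      have "0 \<le> (\<Sum>i<n. of_bool (a $ i = 1) :: int)" by (intro sum_nonneg) simp
      with le show "\<bar>\<Sum>i<n. of_bool (a $ i = 1)\<bar> \<le> int (n + 1)" by linarith
    qed
    fix x assume x: "x \<in> ?C"
    show "real_of_int (eval_form (round_form floor 1 a) x) = ?d a x"
      unfolding eval_form_sum[OF fst_round_form[OF carr] x] snd sq_dist_sum[OF x carr]
        sum.distrib[symmetric] of_int_sum
    proof (intro sum.cong refl)
      fix i assume "i \<in> {..<n}"
      then have i: "i < n" by simp
      show "real_of_int (fst (round_form floor 1 a) $ i * of_bool (x $ i) + of_bool (a $ i = 1)) =
          (of_bool (x $ i) - a $ i)\<^sup>2"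
        using a01[OF i] by (auto simp: fst[OF i])
    qed
    have "?d a x \<le> (\<Sum>i<n. 1)"
      unfolding sq_dist_sum[OF x carr] by (intro sum_mono) (auto dest!: a01)
    then show "?d a x \<le> n" by simp
  qed
  let ?g = "round_form floor 1"
  have "\<exists>Ls Rs kl kr. kstat_rep n Ls Rs kl kr f \<and> length Ls + length Rs \<le> 2 * s * s + 4 * s + 2 \<and>
    set Ls \<union> set Rs \<subseteq> ?g ` ?S \<union> ?g ` ?S \<union> {(0\<^sub>v n, int (n + 1)), (0\<^sub>v n, 0)}"
  proof (rule knn_rep_imp_kstat_rep[OF rep _ _ _ _ s])
    show "fst (?g a) \<in> carrier_vec n" if "a \<in> ?S" for a using that S * by blast
    then show "fst (?g a) \<in> carrier_vec n" if "a \<in> ?S" for a using that .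
    show "eval_form (?g a) x < eval_form (?g b) x \<longleftrightarrow> ?d a x < ?d b x"
      if "a \<in> ?S" "b \<in> ?S" "x \<in> ?C" for a b x
    proof -
      have "real_of_int (eval_form (?g a) x) = ?d a x" "real_of_int (eval_form (?g b) x) = ?d b x"
        using that S *[of a] *[of b] by blast+
      then show ?thesis by (simp flip: of_int_less_iff[where 'a = real])
    qed
    show "eval_form (?g a) x < int (n + 1)" if "a \<in> ?S" "x \<in> ?C" for a x
    proof -
      have "real_of_int (eval_form (?g a) x) = ?d a x" "?d a x \<le> n" using that S *[of a] by blast+
      then show ?thesis by linarith
    qed
  qed
  then obtain Ls Rs kl kr where Ls: "kstat_rep n Ls Rs kl kr f" "length Ls + length Rs \<le> 2 * s * s + 4 * s + 2"
    and sub: "set Ls \<union> set Rs \<subseteq> ?g ` ?S \<union> ?g ` ?S \<union> {(0\<^sub>v n, int (n + 1)), (0\<^sub>v n, 0)}"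
    by (elim exE conjE)
  have "coeffs_bounded (n + 1) L" if "L \<in> set Ls \<union> set Rs" for L
  proof -
    from that sub consider a where "a \<in> ?S" "L = ?g a" | "L = (0\<^sub>v n, int (n + 1))" | "L = (0\<^sub>v n, 0)"
      by blast
    then show ?thesis
    proof cases
      case 1
      then show ?thesis using S * by blast
    qed (simp_all add: coeffs_bounded_def)
  qed
  then show ?thesis using Ls by blast
qed

section \<open>Substitutions in linear forms\<close>

lemma kstat_rep_substitution:
  assumes rep: "kstat_rep m Ls Rs kl kr g" and sub: "substitution n m v"
    and f: "\<And>x. x \<in> carrier_vec n \<Longrightarrow> f x \<longleftrightarrow> g (v x)"
  shows "\<exists>Ls' Rs'. kstat_rep n Ls' Rs' kl kr f \<and> length Ls' = length Ls \<and> length Rs' = length Rs \<and>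
    (\<forall>c. (\<forall>L \<in> set Ls \<union> set Rs. coeffs_bounded c L) \<longrightarrow>
      (\<forall>L \<in> set Ls' \<union> set Rs'. coeffs_bounded ((m + 1) * c) L))"
proof -
  have v: "v x \<in> carrier_vec m" if "x \<in> carrier_vec n" for x
    using sub that by (simp add: substitution_def)
  \<comment> \<open>Each coordinate of \<open>v x\<close> is an affine form in \<open>x\<close>: a
    unit vector for a copied variable, a pure constant otherwise. \<open>T\<close> below composes a
    form with these.\<close>
  have "\<exists>u. fst u \<in> carrier_vec n \<and> coeffs_bounded 1 u \<and>
      (\<forall>x\<in>carrier_vec n. eval_form u x = of_bool (v x $ j))" if "j \<in> {..<m}" for j
  proof -
    from that sub have "(\<exists>i<n. \<forall>x\<in>carrier_vec n. v x $ j = x $ i) \<or> (\<exists>c. \<forall>x\<in>carrier_vec n. v x $ j = c)"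
      by (simp add: substitution_def)
    then consider i where "i < n" "\<forall>x\<in>carrier_vec n. v x $ j = x $ i"
      | c where "\<forall>x\<in>carrier_vec n. v x $ j = c"
      by blast
    then show ?thesis
    proof cases
      case 1
      then show ?thesis
        by (intro exI[of _ "(unit_vec n i, 0)"]) (auto simp: coeffs_bounded_def eval_form_def)
    next
      case 2
      then show ?thesis
        by (intro exI[of _ "(0\<^sub>v n, of_bool c)"]) (auto simp: coeffs_bounded_def eval_form_zero)
    qed
  qed
  then have "\<forall>j\<in>{..<m}. \<exists>u. fst u \<in> carrier_vec n \<and> coeffs_bounded 1 u \<and>
      (\<forall>x\<in>carrier_vec n. eval_form u x = of_bool (v x $ j))" by blast
  from bchoice[OF this] obtain u where u: "\<And>j. j < m \<Longrightarrow> fst (u j) \<in> carrier_vec n"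
    "\<And>j. j < m \<Longrightarrow> coeffs_bounded 1 (u j)"
    "\<And>j x. j < m \<Longrightarrow> x \<in> carrier_vec n \<Longrightarrow> eval_form (u j) x = of_bool (v x $ j)"
    by auto
  define T :: "linear_form \<Rightarrow> linear_form"
    where "T L = (vec n (\<lambda>i. \<Sum>j<m. fst L $ j * fst (u j) $ i),
      (\<Sum>j<m. fst L $ j * snd (u j)) + snd L)" for L
  have T_carrier: "fst (T L) \<in> carrier_vec n" for L by (simp add: T_def)
  have T_eval: "eval_form (T L) x = eval_form L (v x)"
    if "fst L \<in> carrier_vec m" "x \<in> carrier_vec n" for L x
  proof -
    have "eval_form (T L) x =
        (\<Sum>i<n. \<Sum>j<m. fst L $ j * (fst (u j) $ i * of_bool (x $ i))) + (\<Sum>j<m. fst L $ j * snd (u j)) + snd L"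
      unfolding eval_form_sum[OF T_carrier that(2)]
      by (simp add: T_def sum_distrib_right mult.assoc)
    also have "\<dots> = (\<Sum>j<m. fst L $ j * ((\<Sum>i<n. fst (u j) $ i * of_bool (x $ i)) + snd (u j))) + snd L"
      by (subst sum.swap) (simp add: sum_distrib_left ring_distribs sum.distrib mult.assoc
        del: sum_mult_of_bool_eq sum_of_bool_mult_eq)
    also have "\<dots> = (\<Sum>j<m. fst L $ j * of_bool (v x $ j)) + snd L"
    proof -
      have "(\<Sum>i<n. fst (u j) $ i * of_bool (x $ i)) + snd (u j) = of_bool (v x $ j)" if "j < m" for j
        using u(1,3)[OF that] \<open>x \<in> _\<close> eval_form_sum by metis
      then show ?thesis by (intro arg_cong2[where f = "(+)"] sum.cong refl) (simp only: lessThan_iff)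
    qed
    finally show ?thesis using that v by (simp add: eval_form_sum[where n = m])
  qed
  have T_bounded: "coeffs_bounded ((m + 1) * c) (T L)"
    if "fst L \<in> carrier_vec m" "coeffs_bounded c L" for L c
  proof -
    \<comment> \<open>Up to \<open>m\<close> coefficients may collect on one variable or in the
      constant term, where the old constant adds another \<open>c\<close>; hence the factor
      \<open>m + 1\<close>.\<close>
    have bound: "\<bar>\<Sum>j<m. fst L $ j * w j\<bar> \<le> int (m * c)" if w: "\<And>j. j < m \<Longrightarrow> \<bar>w j\<bar> \<le> 1" for w
    proof -
      have "\<bar>\<Sum>j<m. fst L $ j * w j\<bar> \<le> (\<Sum>j<m. int c * 1)"
      proof (intro order_trans[OF sum_abs] sum_mono)
        fix j assume "j \<in> {..<m}"
        then show "\<bar>fst L $ j * w j\<bar> \<le> int c * 1"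
          unfolding abs_mult using \<open>fst L \<in> _\<close> \<open>coeffs_bounded c L\<close> w
          by (intro mult_mono) (auto simp: coeffs_bounded_def)
      qed
      then show ?thesis by simp
    qed
    have "\<bar>fst (u j) $ i\<bar> \<le> 1" if "j < m" "i < n" for i j
      using u(1,2)[OF that(1)] that by (auto simp: coeffs_bounded_def)
    then have "\<bar>fst (T L) $ i\<bar> \<le> int (m * c)" if "i < n" for i
      using that bound[of "\<lambda>j. fst (u j) $ i"] by (simp add: T_def)
    moreover have "\<bar>snd (u j)\<bar> \<le> 1" if "j < m" for j
      using u(2)[OF that] by (auto simp: coeffs_bounded_def)
    then have "\<bar>\<Sum>j<m. fst L $ j * snd (u j)\<bar> \<le> int (m * c)" by (rule bound)
    then have "\<bar>snd (T L)\<bar> \<le> int ((m + 1) * c)"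
      using that(2) by (auto simp: T_def coeffs_bounded_def algebra_simps)
    ultimately show ?thesis
      using T_carrier[of L] by (fastforce simp: coeffs_bounded_def algebra_simps)
  qed
  have carrier: "fst L \<in> carrier_vec m" if "L \<in> set Ls \<union> set Rs" for L
    using rep that by (auto simp: kstat_rep_def)
  have "kstat_rep n (map T Ls) (map T Rs) kl kr f"
    unfolding kstat_rep_def
  proof (intro conjI ballI)
    fix x :: "bool vec" assume x: "x \<in> carrier_vec n"
    have "map (\<lambda>L. eval_form L x) (map T Xs) = map (\<lambda>L. eval_form L (v x)) Xs"
      if "set Xs \<subseteq> set Ls \<union> set Rs" for Xs
      unfolding map_map comp_def
      by (intro map_cong refl T_eval carrier x) (use that in blast)
    then show "f x \<longleftrightarrow> kth_smallest kl (map (\<lambda>L. eval_form L x) (map T Ls))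
        < kth_smallest kr (map (\<lambda>R. eval_form R x) (map T Rs))"
      using rep f[OF x] v[OF x] by (simp add: kstat_rep_def del: map_map)
  qed (use rep T_carrier in \<open>auto simp: kstat_rep_def\<close>)
  moreover have "\<forall>c. (\<forall>L \<in> set Ls \<union> set Rs. coeffs_bounded c L) \<longrightarrow>
      (\<forall>L \<in> set (map T Ls) \<union> set (map T Rs). coeffs_bounded ((m + 1) * c) L)"
  proof (intro allI impI ballI)
    fix c L' assume c: "\<forall>L \<in> set Ls \<union> set Rs. coeffs_bounded c L"
      and "L' \<in> set (map T Ls) \<union> set (map T Rs)"
    then obtain L where L: "L \<in> set Ls \<union> set Rs" "L' = T L" by auto
    then show "coeffs_bounded ((m + 1) * c) L'" using T_bounded[OF carrier[OF L(1)]] c by blast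
  qed
  moreover have "length (map T Ls) = length Ls" "length (map T Rs) = length Rs" by simp_all
  ultimately show ?thesis by blast
qed

lemma subfunctions_kNN_subset: "subfunctions kNN \<subseteq> kSTAT"
proof
  fix f assume "f \<in> subfunctions kNN"
  then obtain g m v s where m: "poly_bounded m" and v: "\<And>n. substitution n (m n) (v n)"
    and f: "\<And>n x. x \<in> carrier_vec n \<Longrightarrow> f x \<longleftrightarrow> g (v n x)" and s: "poly_bounded s"
    and g: "\<And>n. \<exists>k P N. knn_rep n k P N g \<and> card (P \<union> N) \<le> s n"
    unfolding subfunctions_def subfunction_def kNN_def by blast
  let ?s = "\<lambda>n. 2 * s n * s n + 4 * s n + 2"
  have "\<exists>Ls Rs kl kr. kstat_rep n Ls Rs kl kr f \<and> length Ls + length Rs \<le> ?s (m n)" for n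
  proof -
    obtain k P N where "knn_rep (m n) k P N g" "card (P \<union> N) \<le> s (m n)" using g by blast
    from knn_rep_imp_kstat[OF this] obtain Ls Rs kl kr
      where Ls: "kstat_rep (m n) Ls Rs kl kr g" "length Ls + length Rs \<le> ?s (m n)"
      by blast
    from kstat_rep_substitution[OF Ls(1) v[of n] f] obtain Ls' Rs'
      where "kstat_rep n Ls' Rs' kl kr f" "length Ls' = length Ls" "length Rs' = length Rs"
      by blast
    with Ls(2) have "kstat_rep n Ls' Rs' kl kr f \<and> length Ls' + length Rs' \<le> ?s (m n)" by simp
    then show ?thesis by blast
  qed
  moreover have "poly_bounded (\<lambda>n. ?s (m n))"
    by (intro poly_bounded_intros poly_bounded_compose[OF s m])
  ultimately show "f \<in> kSTAT" unfolding kSTAT_def by blast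
qed

lemma subfunctions_kHNN_subset: "subfunctions kHNN \<subseteq> kSTAT_poly"
proof
  fix f assume "f \<in> subfunctions kHNN"
  then obtain g m v s where m: "poly_bounded m" and v: "\<And>n. substitution n (m n) (v n)"
    and f: "\<And>n x. x \<in> carrier_vec n \<Longrightarrow> f x \<longleftrightarrow> g (v n x)" and s: "poly_bounded s"
    and g: "\<And>n. \<exists>k P N. knn_rep n k P N g \<and> P \<subseteq> hypercube n \<and> N \<subseteq> hypercube n \<and> card (P \<union> N) \<le> s n"
    unfolding subfunctions_def subfunction_def kHNN_def by blast
  let ?s = "\<lambda>n. 2 * s n * s n + 4 * s n + 2"
  have "\<exists>Ls Rs kl kr. kstat_rep n Ls Rs kl kr f \<and> length Ls + length Rs \<le> ?s (m n) \<and>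
      (\<forall>L \<in> set Ls \<union> set Rs. coeffs_bounded ((m n + 1) * (m n + 1)) L)" for n
  proof -
    obtain k P N where "knn_rep (m n) k P N g" "card (P \<union> N) \<le> s (m n)" "P \<union> N \<subseteq> hypercube (m n)"
      using g[of "m n"] by blast
    from knn_rep_imp_kstat_poly[OF this] obtain Ls Rs kl kr
      where Ls: "kstat_rep (m n) Ls Rs kl kr g" "length Ls + length Rs \<le> ?s (m n)"
        "\<forall>L \<in> set Ls \<union> set Rs. coeffs_bounded (m n + 1) L"
      by blast
    from kstat_rep_substitution[OF Ls(1) v[of n] f] obtain Ls' Rs'
      where "kstat_rep n Ls' Rs' kl kr f" "length Ls' = length Ls" "length Rs' = length Rs"
        and bounded: "\<forall>c. (\<forall>L \<in> set Ls \<union> set Rs. coeffs_bounded c L) \<longrightarrow>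
          (\<forall>L \<in> set Ls' \<union> set Rs'. coeffs_bounded ((m n + 1) * c) L)"
      by blast
    with Ls(2) have "kstat_rep n Ls' Rs' kl kr f \<and> length Ls' + length Rs' \<le> ?s (m n)" by simp
    \<comment> \<open>One factor \<open>m n + 1\<close> bounds the coefficients in dimension
      \<open>m n\<close>, the other is the cost of substituting.\<close>
    moreover have "\<forall>L \<in> set Ls' \<union> set Rs'. coeffs_bounded ((m n + 1) * (m n + 1)) L"
      using bounded[THEN spec, of "m n + 1"] Ls(3) by (rule mp)
    ultimately show ?thesis by blast
  qed
  moreover have "poly_bounded (\<lambda>n. ?s (m n))"
    by (intro poly_bounded_intros poly_bounded_compose[OF s m])
  moreover have "poly_bounded (\<lambda>n. (m n + 1) * (m n + 1))"
    by (intro poly_bounded_intros m)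
  ultimately show "f \<in> kSTAT_poly" unfolding kSTAT_poly_def by blast
qed

subsection \<open>From order statistics to nearest neighbors\<close>

text \<open>Induction on \<open>k\<close>, adding a nearest remaining element; injectivity of
  \<open>d\<close> excludes ties, so the separation is strict.\<close>

lemma ex_nearest:
  fixes d :: "'a \<Rightarrow> 'b :: linorder"
  assumes "finite S" "inj_on d S" "k \<le> card S"
  shows "\<exists>A \<subseteq> S. card A = k \<and> (\<forall>a \<in> A. \<forall>b \<in> S - A. d a < d b)"
  using assms(3)
proof (induction k)
  case 0
  show ?case by (intro exI[of _ "{}"]) auto
next
  case (Suc k)
  then obtain A where A: "A \<subseteq> S" "card A = k" "\<And>a b. a \<in> A \<Longrightarrow> b \<in> S - A \<Longrightarrow> d a < d b"
    using Suc_leD by blast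
  have finA: "finite A" using A(1) assms(1) by (rule finite_subset)
  have "S - A \<noteq> {}" using Suc.prems A card_mono[OF finA, of S] by auto
  then have *: "arg_min_on d (S - A) \<in> S - A" "\<And>b. b \<in> S - A \<Longrightarrow> d (arg_min_on d (S - A)) \<le> d b"
    using assms(1) arg_min_if_finite(1)[of "S - A" d] arg_min_least[of "S - A" _ d] by auto
  define b0 where "b0 = arg_min_on d (S - A)"
  have b0: "b0 \<in> S - A" "\<And>b. b \<in> S - A \<Longrightarrow> d b0 \<le> d b" using * by (auto simp: b0_def)
  have "d b0 < d b" if "b \<in> S - insert b0 A" for b
    using that b0 assms(2) by (metis DiffD1 Diff_insert2 Diff_iff inj_onD insertCI order_less_le)
  then have "\<forall>a \<in> insert b0 A. \<forall>b \<in> S - insert b0 A. d a < d b" using A(3) by blast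
  moreover have "card (insert b0 A) = Suc k" using b0(1) A(2) finA by simp
  moreover have "insert b0 A \<subseteq> S" using b0(1) A(1) by blast
  ultimately show ?case by blast
qed

text \<open>An odd number \<open>2 * t - 1\<close> of votes goes to \<open>P\<close> exactly if at
  least \<open>t\<close> of them lie in \<open>P\<close>, that is, if the t-th nearest anchor of
  \<open>P\<close> precedes the t-th nearest of \<open>N\<close>. As the distances are distinct, the
  set of nearest anchors exists.\<close>

lemma knn_value_iff_counts:
  fixes y :: "bool vec"
  defines "d \<equiv> sq_dist (embed y)"
  assumes fin: "finite P" "finite N" and disj: "P \<inter> N = {}" and inj: "inj_on d (P \<union> N)"
    and t: "0 < t" "t \<le> card P" "t \<le> card N"
  shows "knn_value (2 * t - 1) P N y \<longleftrightarrow>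
    (\<exists>\<theta>. t \<le> card {a \<in> P. d a \<le> \<theta>} \<and> card {b \<in> N. d b \<le> \<theta>} < t)" (is "_ \<longleftrightarrow> ?r")
proof
  assume "knn_value (2 * t - 1) P N y"
  then obtain A where A: "A \<subseteq> P \<union> N" "card A = 2 * t - 1" "card (A \<inter> P) \<ge> card (A \<inter> N)"
    and sep: "\<And>a b. a \<in> A \<Longrightarrow> b \<in> (P \<union> N) - A \<Longrightarrow> d a < d b"
    unfolding knn_value_def d_def by blast
  have finA: "finite A" using A(1) fin by (auto intro: finite_subset)
  have "card A = card (A \<inter> P \<union> A \<inter> N)" using A(1) by (intro arg_cong[where f = card]) auto
  also have "\<dots> = card (A \<inter> P) + card (A \<inter> N)"
    using finA disj by (intro card_Un_disjoint) auto
  finally have AP: "t \<le> card (A \<inter> P)" and AN: "card (A \<inter> N) < t" using A t by linarith+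
  have "A \<inter> P \<noteq> {}" using AP t(1) by force
  then have "Max (d ` (A \<inter> P)) \<in> d ` (A \<inter> P)" using finA by (intro Max_in) auto
  then obtain a0 where a0: "a0 \<in> A \<inter> P" "Max (d ` (A \<inter> P)) = d a0" by auto
  have "d a \<le> d a0" if "a \<in> A \<inter> P" for a
    unfolding a0(2)[symmetric] using that finA by (intro Max_ge) auto
  then have "card (A \<inter> P) \<le> card {a \<in> P. d a \<le> d a0}" using fin by (intro card_mono) auto
  moreover have "{b \<in> N. d b \<le> d a0} \<subseteq> A \<inter> N" using sep[of a0] a0(1) by (auto simp: not_less[symmetric])
  then have "card {b \<in> N. d b \<le> d a0} \<le> card (A \<inter> N)" using fin by (intro card_mono) auto
  ultimately show ?r using AP AN by (intro exI[of _ "d a0"]) linarith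
next
  assume ?r
  then obtain \<theta> where \<theta>: "t \<le> card {a \<in> P. d a \<le> \<theta>}" "card {b \<in> N. d b \<le> \<theta>} < t" by blast
  have "card (P \<union> N) = card P + card N" using fin disj by (rule card_Un_disjoint)
  then have "2 * t - 1 \<le> card (P \<union> N)" using t by linarith
  from ex_nearest[OF _ inj this] fin obtain A where A: "A \<subseteq> P \<union> N" "card A = 2 * t - 1"
    and sep: "\<forall>a \<in> A. \<forall>b \<in> (P \<union> N) - A. d a < d b" by auto
  have finA: "finite A" using A(1) fin by (auto intro: finite_subset)
  have "card A = card (A \<inter> P \<union> A \<inter> N)" using A(1) by (intro arg_cong[where f = card]) auto
  also have "\<dots> = card (A \<inter> P) + card (A \<inter> N)"
    using finA disj by (intro card_Un_disjoint) auto
  finally have sum: "card (A \<inter> P) + card (A \<inter> N) = 2 * t - 1" using A by simp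
  \<comment> \<open>If \<open>N\<close> won, \<open>A\<close> would contain an anchor of
    \<open>N\<close> beyond \<theta> and miss an anchor of \<open>P\<close> within \<theta>,
    contradicting that \<open>A\<close> consists of nearest anchors.\<close>
  have "card (A \<inter> N) \<le> card (A \<inter> P)"
  proof (rule ccontr)
    assume "\<not> card (A \<inter> N) \<le> card (A \<inter> P)"
    then have lt: "card (A \<inter> P) < t" "t \<le> card (A \<inter> N)" using sum by linarith+
    have "\<not> A \<inter> N \<subseteq> {b \<in> N. d b \<le> \<theta>}"
    proof
      assume "A \<inter> N \<subseteq> {b \<in> N. d b \<le> \<theta>}"
      then have "card (A \<inter> N) \<le> card {b \<in> N. d b \<le> \<theta>}" using fin by (intro card_mono) auto
      with lt \<theta> show False by linarith
    qed
    then obtain b where b: "b \<in> A" "b \<in> N" "\<not> d b \<le> \<theta>" by blast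
    have "\<not> {a \<in> P. d a \<le> \<theta>} \<subseteq> A \<inter> P"
    proof
      assume "{a \<in> P. d a \<le> \<theta>} \<subseteq> A \<inter> P"
      then have "card {a \<in> P. d a \<le> \<theta>} \<le> card (A \<inter> P)" using finA by (intro card_mono) auto
      with lt \<theta> show False by linarith
    qed
    then obtain a where a: "a \<in> P" "d a \<le> \<theta>" "a \<notin> A" by auto
    from sep a b have "d b < d a" by blast
    with a b show False by simp
  qed
  then show "knn_value (2 * t - 1) P N y"
    unfolding knn_value_def using A sep by (auto simp: d_def)
qed

lemma card_nth_append:
  "card {i \<in> {length xs..<length (xs @ ys)}. p ((xs @ ys) ! i)} = length (filter p ys)"
proof -
  have "{i \<in> {length xs..<length (xs @ ys)}. p ((xs @ ys) ! i)} =
      (\<lambda>i. length xs + i) ` {i. i < length ys \<and> p (ys ! i)}"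
  proof (intro equalityI subsetI)
    fix i assume "i \<in> {i \<in> {length xs..<length (xs @ ys)}. p ((xs @ ys) ! i)}"
    then show "i \<in> (\<lambda>i. length xs + i) ` {i. i < length ys \<and> p (ys ! i)}"
      by (intro image_eqI[of _ _ "i - length xs"]) (auto simp: nth_append)
  qed auto
  then show ?thesis by (simp add: card_image length_filter_conv_card)
qed

lemma card_nth_append_left:
  "card {i \<in> {..<length xs}. p ((xs @ ys) ! i)} = length (filter p xs)"
  unfolding length_filter_conv_card by (intro arg_cong[where f = card]) (auto simp: nth_append)

text \<open>Padding both lists with a common lower bound equalises the two ranks.\<close>

lemma kstat_rep_counts:
  fixes Ls Rs :: "linear_form list" and n c kl kr :: nat
  defines "F \<equiv> (replicate kl (0\<^sub>v n, - int ((n + 1) * c)) @ Rs) @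
    (replicate kr (0\<^sub>v n, - int ((n + 1) * c)) @ Ls)"
  assumes rep: "kstat_rep n Ls Rs kl kr f" and bounded: "\<forall>L \<in> set Ls \<union> set Rs. coeffs_bounded c L"
    and x: "x \<in> carrier_vec n"
  shows "f x \<longleftrightarrow> (\<exists>\<theta>. kl + kr \<le> card {i \<in> {kl + length Rs..<length F}. eval_form (F ! i) x \<le> \<theta>} \<and>
    card {i \<in> {..<kl + length Rs}. eval_form (F ! i) x \<le> \<theta>} < kl + kr)"
proof -
  let ?B = "int ((n + 1) * c)"
  let ?N = "replicate kl (0\<^sub>v n, - ?B) @ Rs" and ?P = "replicate kr (0\<^sub>v n, - ?B) @ Ls"
  let ?cnt = "\<lambda>\<theta> Ls. length (filter (\<lambda>L. eval_form L x \<le> \<theta>) Ls)"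
  have carrier: "fst L \<in> carrier_vec n" if "L \<in> set Ls \<union> set Rs" for L
    using rep that by (auto simp: kstat_rep_def)
  have "f x \<longleftrightarrow> (\<exists>\<theta>. kl \<le> ?cnt \<theta> Ls \<and> ?cnt \<theta> Rs < kr)"
    using rep x by (simp add: kstat_rep_def kth_smallest_less_iff filter_map comp_def)
  also have "\<dots> \<longleftrightarrow> (\<exists>\<theta>. kl + kr \<le> ?cnt \<theta> ?P \<and> ?cnt \<theta> ?N < kl + kr)"
  proof (intro ex_cong1)
    fix \<theta> :: int
    show "kl \<le> ?cnt \<theta> Ls \<and> ?cnt \<theta> Rs < kr \<longleftrightarrow> kl + kr \<le> ?cnt \<theta> ?P \<and> ?cnt \<theta> ?N < kl + kr"
    \<comment> \<open>Once \<theta> reaches the padding value, both sides of each inequality grow by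
      the same number, \<open>kr\<close> on the left and \<open>kl\<close> on the right. Below it no
      left form is counted, and both left conditions fail because \<open>kl\<close> is
      positive.\<close>
    proof (cases "- ?B \<le> \<theta>")
      case True
      then have "eval_form (0\<^sub>v n, - ?B) x \<le> \<theta>" using x by (simp add: eval_form_zero)
      then show ?thesis by auto
    next
      case False
      have "- ?B \<le> eval_form L x" if "L \<in> set Ls" for L
        using abs_eval_form_le[OF carrier x, of L c] bounded that by auto
      then have "filter (\<lambda>L. eval_form L x \<le> \<theta>) Ls = []"
        using False by (auto simp: filter_empty_conv) (meson order_trans)
      moreover have "\<not> eval_form (0\<^sub>v n, - ?B) x \<le> \<theta>" using x False by (simp add: eval_form_zero)
      moreover have "1 \<le> kl" using rep by (simp add: kstat_rep_def)
      ultimately show ?thesis by simp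
    qed
  qed
  also have "\<dots> \<longleftrightarrow> (\<exists>\<theta>. kl + kr \<le> card {i \<in> {length ?N..<length (?N @ ?P)}. eval_form ((?N @ ?P) ! i) x \<le> \<theta>} \<and>
      card {i \<in> {..<length ?N}. eval_form ((?N @ ?P) ! i) x \<le> \<theta>} < kl + kr)"
    by (simp only: card_nth_append[where p = "\<lambda>L. eval_form L x \<le> \<theta>" for \<theta>]
      card_nth_append_left[where p = "\<lambda>L. eval_form L x \<le> \<theta>" for \<theta>])
  finally show ?thesis unfolding F_def by simp
qed

text \<open>\<open>perturb T i L\<close> makes the values of different forms distinct at every point, as they differ
  modulo \<open>T\<close>, and turns \<open>\<ge>\<close> into \<open>>\<close> in favour of the larger index.\<close>

definition perturb :: "nat \<Rightarrow> nat \<Rightarrow> linear_form \<Rightarrow> linear_form" where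
  "perturb T i L = (int T \<cdot>\<^sub>v fst L, int T * snd L + int i)"

lemma fst_perturb: "fst L \<in> carrier_vec n \<Longrightarrow> fst (perturb T i L) \<in> carrier_vec n"
  by (simp add: perturb_def)

lemma eval_perturb:
  assumes "fst L \<in> carrier_vec n" "x \<in> carrier_vec n"
  shows "eval_form (perturb T i L) x = int T * eval_form L x + int i"
  unfolding eval_form_sum[OF fst_perturb[OF assms(1)] assms(2)] eval_form_sum[OF assms]
  using assms by (simp add: perturb_def ring_distribs sum_distrib_left mult.assoc
    del: sum_mult_of_bool_eq sum_of_bool_mult_eq)

lemma coeffs_bounded_perturb:
  assumes "coeffs_bounded c L" "i < T"
  shows "coeffs_bounded (T * c + T) (perturb T i L)"
proof -
  have *: "\<bar>int T * z\<bar> \<le> int (T * c)" if "\<bar>z\<bar> \<le> int c" for z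
    using that by (simp add: abs_mult mult_left_mono)
  show ?thesis
    unfolding coeffs_bounded_def
  proof (intro conjI allI impI)
    fix j assume "j < dim_vec (fst (perturb T i L))"
    then show "\<bar>fst (perturb T i L) $ j\<bar> \<le> int (T * c + T)"
      using assms(1) *[of "fst L $ j"] by (simp add: perturb_def coeffs_bounded_def)
  next
    show "\<bar>snd (perturb T i L)\<bar> \<le> int (T * c + T)"
      using assms *[of "snd L"] by (auto simp: perturb_def coeffs_bounded_def)
  qed
qed

lemma perturbed_eq_iff:
  fixes u w :: int
  assumes "i < T" "j < T"
  shows "int T * u + int i = int T * w + int j \<longleftrightarrow> u = w \<and> i = j"
proof
  assume eq: "int T * u + int i = int T * w + int j"
  then have "(int T * u + int i) div int T = (int T * w + int j) div int T" by simp
  then have "u = w" using assms by simp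
  with eq show "u = w \<and> i = j" by simp
qed simp

text \<open>A unit gap between \<open>u\<close> and \<open>w\<close> becomes \<open>T\<close>, more
  than any difference of indices. If \<open>u = w\<close>, then \<open>j < i\<close> keeps the
  strict inequality false.\<close>

lemma perturbed_less_iff:
  fixes u w :: int
  assumes "i < T" "j < i"
  shows "int T * u + int i < int T * w + int j \<longleftrightarrow> u < w"
proof
  assume "int T * u + int i < int T * w + int j"
  then have "int T * u < int T * w" using assms by linarith
  then show "u < w" using assms by simp
next
  assume "u < w"
  then have "int T * (u + 1) \<le> int T * w" by (intro mult_left_mono) auto
  then show "int T * u + int i < int T * w + int j" using assms by (simp add: distrib_left)
qed

text \<open>The hypothesis \<open>anchors\<close> isolates the geometry: distances are an increasing
  affine image of the given forms, with \<alpha> and \<gamma> shared by all anchors, so they are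
  ordered as the forms are. Real and Boolean anchors then differ only in \<open>H\<close> and
  \<open>v\<close>.\<close>

lemma kstat_rep_imp_knn_value:
  fixes v :: "bool vec \<Rightarrow> bool vec" and H :: "real vec set"
  assumes rep: "kstat_rep n Ls Rs kl kr f"
    and bounded: "\<forall>L \<in> set Ls \<union> set Rs. coeffs_bounded c L"
    and S: "length Ls + length Rs \<le> S"
    and anchors: "\<And>G. length G \<le> 2 * S \<Longrightarrow> (\<And>L. L \<in> set G \<Longrightarrow> fst L \<in> carrier_vec n) \<Longrightarrow>
      (\<And>L. L \<in> set G \<Longrightarrow> coeffs_bounded (2 * S * ((n + 1) * c) + 2 * S) L) \<Longrightarrow>
      \<exists>a \<alpha> \<gamma>. 0 < \<alpha> \<and> inj_on a {..<length G} \<and> a ` {..<length G} \<subseteq> H \<and>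
        (\<forall>i<length G. \<forall>x \<in> carrier_vec n. sq_dist (embed (v x)) (a i) = \<alpha> * of_int (eval_form (G ! i) x) + \<gamma>)"
  shows "\<exists>k P N. finite P \<and> finite N \<and> P \<inter> N = {} \<and> P \<union> N \<subseteq> H \<and> k > 0 \<and> card (P \<union> N) \<le> 2 * S \<and>
    (\<forall>x \<in> carrier_vec n. f x \<longleftrightarrow> knn_value k P N (v x))"
proof -
  let ?pad = "(0\<^sub>v n, - int ((n + 1) * c)) :: linear_form"
  \<comment> \<open>The right forms, which become \<open>N\<close>, come first. Every left form thus
    has a larger index than every right form, so the perturbation resolves a tie between the sides
    against the left, as the strict inequality demands.\<close>
  define F where "F = (replicate kl ?pad @ Rs) @ (replicate kr ?pad @ Ls)"
  define r where "r = kl + length Rs"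
  define T where "T = length F"
  define t where "t = kl + kr"
  have k: "1 \<le> kl" "kl \<le> length Ls" "1 \<le> kr" "kr \<le> length Rs" using rep by (auto simp: kstat_rep_def)
  have T: "T = r + (kr + length Ls)" by (simp add: T_def F_def r_def)
  have T2: "T \<le> 2 * S" using S k by (simp add: T r_def)
  have F_set: "L = ?pad \<or> L \<in> set Ls \<union> set Rs" if "L \<in> set F" for L
    using that by (auto simp: F_def split: if_splits)
  have F_carrier: "fst L \<in> carrier_vec n" if "L \<in> set F" for L
    using F_set[OF that] rep by (auto simp: kstat_rep_def)
  have F_bounded: "coeffs_bounded ((n + 1) * c) L" if "L \<in> set F" for L
  proof (cases "L = ?pad")
    case True
    then show ?thesis
      by (simp add: coeffs_bounded_def del: of_nat_mult of_nat_add of_nat_Suc mult_Suc)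
  next
    case False
    then have "coeffs_bounded c L" using F_set[OF that] bounded by blast
    then show ?thesis by (rule coeffs_bounded_mono) simp
  qed
  define G where "G = map (\<lambda>i. perturb T i (F ! i)) [0..<T]"
  have lenG: "length G = T" by (simp add: G_def)
  have G_eval: "eval_form (G ! i) x = int T * eval_form (F ! i) x + int i"
    if "i < T" "x \<in> carrier_vec n" for i x
    using that F_carrier[of "F ! i"] by (simp add: G_def T_def eval_perturb)
  have "\<exists>a \<alpha> \<gamma>. 0 < \<alpha> \<and> inj_on a {..<length G} \<and> a ` {..<length G} \<subseteq> H \<and>
      (\<forall>i<length G. \<forall>x \<in> carrier_vec n. sq_dist (embed (v x)) (a i) = \<alpha> * of_int (eval_form (G ! i) x) + \<gamma>)"
  proof (rule anchors)
    fix L assume "L \<in> set G"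
    then obtain i where i: "i < T" "L = perturb T i (F ! i)" by (auto simp: G_def)
    then have Fi: "F ! i \<in> set F" by (simp add: T_def)
    show "fst L \<in> carrier_vec n" using F_carrier[OF Fi] i by (simp add: fst_perturb)
    \<comment> \<open>The padding constant raises the coefficient bound to
      \<open>(n + 1) * c\<close>; perturbing multiplies by \<open>T\<close> and adds an index below
      \<open>T\<close>.\<close>
    have "T * ((n + 1) * c) + T \<le> 2 * S * ((n + 1) * c) + 2 * S"
      using T2 by (intro add_mono mult_right_mono) auto
    then show "coeffs_bounded (2 * S * ((n + 1) * c) + 2 * S) L"
      using coeffs_bounded_perturb[OF F_bounded[OF Fi] i(1)] coeffs_bounded_mono unfolding i(2) by blast
  qed (use T2 lenG in simp)
  then obtain a \<alpha> \<gamma> where \<alpha>: "0 < \<alpha>" and inj: "inj_on a {..<T}" and H: "a ` {..<T} \<subseteq> H"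
    and dist: "\<And>i x. i < T \<Longrightarrow> x \<in> carrier_vec n \<Longrightarrow>
      sq_dist (embed (v x)) (a i) = \<alpha> * of_int (int T * eval_form (F ! i) x + int i) + \<gamma>"
    unfolding lenG using G_eval by (metis (no_types, lifting))
  let ?P = "a ` {r..<T}" and ?N = "a ` {..<r}"
  have union: "{r..<T} \<union> {..<r} = {..<T}" using T by auto
  have PN: "?P \<union> ?N = a ` {..<T}" unfolding union[symmetric] image_Un ..
  have subs: "{r..<T} \<subseteq> {..<T}" "{..<r} \<subseteq> {..<T}" using T by auto
  have disj: "?P \<inter> ?N = {}"
    using inj_on_image_Int[OF inj subs] by auto
  have repr: "f x \<longleftrightarrow> knn_value (2 * t - 1) ?P ?N (v x)" if x: "x \<in> carrier_vec n" for x
  proof -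
    let ?d = "sq_dist (embed (v x))"
    have count: "card {b \<in> a ` I. ?d b \<le> \<theta>} = card {i \<in> I. ?d (a i) \<le> \<theta>}" if "I \<subseteq> {..<T}" for I \<theta>
    proof -
      have "{b \<in> a ` I. ?d b \<le> \<theta>} = a ` {i \<in> I. ?d (a i) \<le> \<theta>}" by auto
      moreover have "{i \<in> I. ?d (a i) \<le> \<theta>} \<subseteq> {..<T}" using that by blast
      ultimately show ?thesis using card_image[OF inj_on_subset[OF inj]] by metis
    qed
    have "inj_on ?d (?P \<union> ?N)"
      unfolding PN
    proof (intro inj_onI)
      fix p q assume "p \<in> a ` {..<T}" "q \<in> a ` {..<T}" and eq: "?d p = ?d q"
      then obtain i j where ij: "i < T" "j < T" "p = a i" "q = a j" by auto
      then have "int T * eval_form (F ! i) x + int i = int T * eval_form (F ! j) x + int j"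
        using eq \<alpha> dist[OF _ x] by (simp del: of_int_add of_int_mult)
      then show "p = q" using ij perturbed_eq_iff[of i T j] by blast
    qed
    moreover have "card ?P = T - r" "card ?N = r"
      using inj_on_subset[OF inj] subs by (auto simp: card_image)
    ultimately have "knn_value (2 * t - 1) ?P ?N (v x) \<longleftrightarrow>
        (\<exists>\<theta>. t \<le> card {b \<in> ?P. ?d b \<le> \<theta>} \<and> card {b \<in> ?N. ?d b \<le> \<theta>} < t)"
      using disj k T by (intro knn_value_iff_counts) (auto simp: t_def r_def)
    also have "\<dots> \<longleftrightarrow> (\<exists>\<theta>. t \<le> card {i \<in> {r..<T}. ?d (a i) \<le> \<theta>} \<and> card {i \<in> {..<r}. ?d (a i) \<le> \<theta>} < t)"
      unfolding count[OF subs(1)] count[OF subs(2)] ..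
    also have "\<dots> \<longleftrightarrow> (\<exists>\<theta>. t \<le> card {i \<in> {r..<T}. eval_form (F ! i) x \<le> \<theta>} \<and>
        card {i \<in> {..<r}. eval_form (F ! i) x \<le> \<theta>} < t)"
    proof (intro order_statistic_cong)
      fix i j assume "i \<in> {r..<T}" "j \<in> {..<r}"
      then show "?d (a i) < ?d (a j) \<longleftrightarrow> eval_form (F ! i) x < eval_form (F ! j) x"
        using \<alpha> dist[OF _ x] perturbed_less_iff[of i T j] by (simp del: of_int_add of_int_mult)
    qed (use k in \<open>auto simp: t_def\<close>)
    also have "\<dots> \<longleftrightarrow> f x"
      unfolding t_def r_def T_def F_def using kstat_rep_counts[OF rep bounded x] ..
    finally show ?thesis ..
  qed
  have "card (?P \<union> ?N) \<le> 2 * S" unfolding PN using card_image_le[of "{..<T}" a] T2 by simp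
  then show ?thesis
    using repr disj H k unfolding PN[symmetric]
    by (intro exI[of _ "2 * t - 1"] exI[of _ ?P] exI[of _ ?N]) (auto simp: t_def)
qed

section \<open>Anchors realising prescribed linear forms as distances\<close>

definition spread :: "nat \<Rightarrow> nat \<Rightarrow> bool vec \<Rightarrow> bool vec" where
  "spread K m x = vec m (\<lambda>j. if j < dim_vec x * K then x $ (j div K) else False)"

lemma spread_carrier: "spread K m x \<in> carrier_vec m"
  by (simp add: spread_def)

lemma substitution_spread: "substitution n m (spread K m)"
  unfolding substitution_def
proof (intro conjI ballI allI impI)
  fix j assume j: "j < m"
  show "(\<exists>i<n. \<forall>x\<in>carrier_vec n. spread K m x $ j = x $ i) \<or>
      (\<exists>c. \<forall>x\<in>carrier_vec n. spread K m x $ j = c)"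
  proof (cases "j < n * K")
    case True
    then have "j div K < n" by (rule less_mult_imp_div_less)
    with True j show ?thesis by (intro disjI1 exI[of _ "j div K"]) (auto simp: spread_def)
  next
    case False
    with j show ?thesis by (intro disjI2 exI[of _ False]) (auto simp: spread_def)
  qed
qed (rule spread_carrier)

lemma sq_dist_spread:
  assumes a: "a \<in> carrier_vec m" and x: "x \<in> carrier_vec n" and m: "n * K \<le> m"
  shows "sq_dist (embed (spread K m x)) a =
    (\<Sum>i<n. \<Sum>j\<in>{i * K..<i * K + K}. (of_bool (x $ i) - a $ j)\<^sup>2) + (\<Sum>j\<in>{n * K..<m}. (a $ j)\<^sup>2)"
proof -
  let ?y = "spread K m x"
  have "sq_dist (embed ?y) a = (\<Sum>j<m. (of_bool (?y $ j) - a $ j)\<^sup>2)"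
    by (rule sq_dist_sum[OF spread_carrier a])
  also have "{..<m} = {..<n * K} \<union> {n * K..<m}" using m by auto
  also have "(\<Sum>j\<in>\<dots>. (of_bool (?y $ j) - a $ j)\<^sup>2) =
      (\<Sum>j<n * K. (of_bool (?y $ j) - a $ j)\<^sup>2) + (\<Sum>j\<in>{n * K..<m}. (of_bool (?y $ j) - a $ j)\<^sup>2)"
    by (intro sum.union_disjoint) auto
  also have "(\<Sum>j\<in>{n * K..<m}. (of_bool (?y $ j) - a $ j)\<^sup>2) = (\<Sum>j\<in>{n * K..<m}. (a $ j)\<^sup>2)"
    using x by (intro sum.cong) (auto simp: spread_def)
  also have "(\<Sum>j<n * K. (of_bool (?y $ j) - a $ j)\<^sup>2) =
      (\<Sum>i<n. \<Sum>j\<in>{i * K..<i * K + K}. (of_bool (?y $ j) - a $ j)\<^sup>2)"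
    by (rule sum.nat_group[symmetric])
  also have "\<dots> = (\<Sum>i<n. \<Sum>j\<in>{i * K..<i * K + K}. (of_bool (x $ i) - a $ j)\<^sup>2)"
  proof (intro sum.cong refl)
    fix i j assume i: "i \<in> {..<n}" and j: "j \<in> {i * K..<i * K + K}"
    have "j < n * K"
    proof -
      have "j < (i + 1) * K" using j by simp
      also have "\<dots> \<le> n * K" using i by (intro mult_right_mono) auto
      finally show ?thesis .
    qed
    moreover have "j div K = i" using j by (intro div_nat_eqI) (auto simp: algebra_simps)
    ultimately have "?y $ j = x $ i" using x m by (simp add: spread_def)
    then show "(of_bool (?y $ j) - a $ j)\<^sup>2 = (of_bool (x $ i) - a $ j)\<^sup>2" by simp
  qed
  finally show ?thesis .
qed

text \<open>With \<open>h = (1 - l) / 2\<close> one has \<open>(x - h)\<^sup>2 = l * x + h\<^sup>2\<close> for \<open>x \<in> {0, 1}\<close>. A further coordinate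
  for each anchor corrects the constant term and makes the anchors distinct.\<close>

lemma real_anchors:
  assumes carrier: "\<And>L. L \<in> set G \<Longrightarrow> fst L \<in> carrier_vec n" and m: "n + length G \<le> m"
  shows "\<exists>a (\<alpha> :: real) \<gamma>. 0 < \<alpha> \<and> inj_on a {..<length G} \<and> a ` {..<length G} \<subseteq> carrier_vec m \<and>
    (\<forall>i<length G. \<forall>x \<in> carrier_vec n.
      sq_dist (embed (spread 1 m x)) (a i) = \<alpha> * of_int (eval_form (G ! i) x) + \<gamma>)"
proof -
  define h where "h i j = (1 - real_of_int (fst (G ! i) $ j)) / 2" for i j
  define e where "e i = real_of_int (snd (G ! i)) - (\<Sum>j<n. (h i j)\<^sup>2)" for i
  \<comment> \<open>\<gamma> exceeds every \<open>\<bar>e i\<bar>\<close>, so the root in the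
    private coordinate \<open>n + i\<close> is real and nonzero; being nonzero is what separates the
    anchors.\<close>
  define \<gamma> where "\<gamma> = 1 + (\<Sum>i<length G. \<bar>e i\<bar>)"
  have pos: "0 < \<gamma> + e i" if "i < length G" for i
    using member_le_sum[of i "{..<length G}" "\<lambda>i. \<bar>e i\<bar>"] that by (simp add: \<gamma>_def)
  define a where "a i = vec m (\<lambda>j. if j < n then h i j else if j = n + i then sqrt (\<gamma> + e i) else 0)" for i
  have "inj_on a {..<length G}"
  proof (intro inj_onI, rule ccontr)
    fix i i' assume i: "i \<in> {..<length G}" "i' \<in> {..<length G}" and eq: "a i = a i'" and neq: "i \<noteq> i'"
    have "a i $ (n + i) = sqrt (\<gamma> + e i)" "a i' $ (n + i) = 0"
      using i neq m by (auto simp: a_def)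
    with eq pos[of i] i show False by simp
  qed
  moreover have "sq_dist (embed (spread 1 m x)) (a i) = 1 * of_int (eval_form (G ! i) x) + \<gamma>"
    if i: "i < length G" and x: "x \<in> carrier_vec n" for i x
  proof -
    have "sq_dist (embed (spread 1 m x)) (a i) =
        (\<Sum>j<n. (of_bool (x $ j) - a i $ j)\<^sup>2) + (\<Sum>j\<in>{n..<m}. (a i $ j)\<^sup>2)"
      using sq_dist_spread[of "a i" m x n 1] x m by (simp add: a_def)
    also have "(\<Sum>j<n. (of_bool (x $ j) - a i $ j)\<^sup>2) =
        (\<Sum>j<n. of_int (fst (G ! i) $ j) * of_bool (x $ j) + (h i j)\<^sup>2)"
      using m by (intro sum.cong refl) (auto simp: a_def h_def field_simps power2_eq_square)
    also have "(\<Sum>j\<in>{n..<m}. (a i $ j)\<^sup>2) = (\<Sum>j\<in>{n + i}. \<gamma> + e i)"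
      using i m pos[OF i] by (intro sum.mono_neutral_cong_right) (auto simp: a_def)
    finally show ?thesis
      using carrier[of "G ! i"] i x
      by (simp add: eval_form_sum[where n = n] sum.distrib e_def
        del: sum_mult_of_bool_eq sum_of_bool_mult_eq)
  qed
  moreover have "a ` {..<length G} \<subseteq> carrier_vec m" by (auto simp: a_def)
  ultimately show ?thesis
    by (intro exI[of _ a] exI[of _ "1 :: real"] exI[of _ \<gamma>]) simp
qed

lemma sum_shift_block:
  fixes g :: "nat \<Rightarrow> real"
  shows "(\<Sum>p\<in>{b..<b + K}. g p) = (\<Sum>q<K. g (b + q))"
  using sum.shift_bounds_nat_ivl[of g 0 b K] by (simp add: atLeast0LessThan add.commute)

text \<open>The sum counts the positions where a constant block of value \<open>b\<close> disagrees
  with \<open>r\<close> leading ones.\<close>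

lemma sum_sq_diff_of_bool:
  assumes "r \<le> K"
  shows "(\<Sum>q<K. (of_bool b - of_bool (q < r))\<^sup>2) = (if b then real K - real r else real r)"
proof -
  have "{..<K} \<inter> {q. q < r} = {..<r}" using assms by auto
  then have sum: "(\<Sum>q<K. of_bool (q < r)) = real r" by simp
  have "(\<Sum>q<K. (of_bool b - of_bool (q < r))\<^sup>2) =
      (\<Sum>q<K. if b then 1 - of_bool (q < r) else of_bool (q < r) :: real)"
    by (intro sum.cong) auto
  then show ?thesis using sum by (cases b) (simp_all only: if_True if_False sum_subtractf sum, simp)
qed

text \<open>Each variable occurs \<open>2 * c\<close> times; an anchor with \<open>c - l\<close> ones among these positions
  contributes \<open>2 * l * x + (c - l)\<close>. The constant term is encoded in a further block in which the
  substituted point is 0, and the last block makes the anchors distinct.\<close>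

lemma boolean_anchors:
  assumes carrier: "\<And>L. L \<in> set G \<Longrightarrow> fst L \<in> carrier_vec n"
    and bounded: "\<And>L. L \<in> set G \<Longrightarrow> coeffs_bounded c L"
    and m: "n * (2 * c) + (4 * c + 2 * c * n) + length G \<le> m"
  shows "\<exists>a (\<alpha> :: real) \<gamma>. 0 < \<alpha> \<and> inj_on a {..<length G} \<and> a ` {..<length G} \<subseteq> hypercube m \<and>
    (\<forall>i<length G. \<forall>x \<in> carrier_vec n.
      sq_dist (embed (spread (2 * c) m x)) (a i) = \<alpha> * of_int (eval_form (G ! i) x) + \<gamma>)"
proof -
  let ?l = "\<lambda>i j. fst (G ! i) $ j"
  define K where "K = 2 * c"
  define W where "W = 4 * c + 2 * c * n"
  have m': "n * K + W + length G \<le> m" using m by (simp add: K_def W_def)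
  have l: "\<bar>?l i j\<bar> \<le> int c" if "i < length G" "j < n" for i j
    using carrier[of "G ! i"] bounded[of "G ! i"] that by (auto simp: coeffs_bounded_def)
  have s: "\<bar>snd (G ! i)\<bar> \<le> int c" if "i < length G" for i
    using bounded[of "G ! i"] that by (auto simp: coeffs_bounded_def)
  define r where "r i j = nat (int c - ?l i j)" for i j
  have r: "int (r i j) = int c - ?l i j" "r i j \<le> K" if "i < length G" "j < n" for i j
    using l[OF that] by (auto simp: r_def K_def)
  \<comment> \<open>Since \<open>2 * snd (G ! i)\<close> is at least \<open>- 2 * c\<close> and the
    \<open>r i j\<close> sum to at most \<open>2 * c * n\<close>, the offset \<open>C\<close> keeps
    \<open>w i\<close> nonnegative. The upper bound \<open>2 * c + C\<close> is the block length
    \<open>W\<close>.\<close>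
  define C where "C = int (2 * c + 2 * c * n)"
  define w where "w i = nat (2 * snd (G ! i) + C - (\<Sum>j<n. int (r i j)))" for i
  have w: "int (w i) = 2 * snd (G ! i) + C - (\<Sum>j<n. int (r i j))" "w i \<le> W"
    if i: "i < length G" for i
  proof -
    have "(\<Sum>j<n. int (r i j)) \<le> (\<Sum>j<n. int K)"
      by (intro sum_mono) (use r(2)[OF i] in auto)
    then have "(\<Sum>j<n. int (r i j)) \<le> int (2 * c * n)" by (simp add: K_def algebra_simps)
    then show "int (w i) = 2 * snd (G ! i) + C - (\<Sum>j<n. int (r i j))"
      using s[OF i] by (simp add: w_def C_def)
    moreover have "0 \<le> (\<Sum>j<n. int (r i j))" by (intro sum_nonneg) auto
    ultimately show "w i \<le> W" using s[OF i] unfolding C_def W_def by linarith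
  qed
  define a :: "nat \<Rightarrow> real vec" where "a i = vec m (\<lambda>j. if j < n * K then of_bool (j mod K < r i (j div K))
    else of_bool (j < n * K + w i \<or> j = n * K + W + i))" for i
  have "inj_on a {..<length G}"
  proof (intro inj_onI, rule ccontr)
    fix i i' assume i: "i \<in> {..<length G}" "i' \<in> {..<length G}" and eq: "a i = a i'" and neq: "i \<noteq> i'"
    have "a i $ (n * K + W + i) = 1" "a i' $ (n * K + W + i) = 0"
      using i neq m' w(2)[of i'] by (auto simp: a_def)
    with eq show False by simp
  qed
  \<comment> \<open>A block contributes \<open>c - l\<close> mismatches if its variable is 0 and
    \<open>c + l\<close> if it is 1, hence the factor 2. The extra 1 is the coordinate marking
    anchor \<open>i\<close>.\<close>
  moreover have "sq_dist (embed (spread K m x)) (a i) = 2 * of_int (eval_form (G ! i) x) + (of_int C + 1)"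
    if i: "i < length G" and x: "x \<in> carrier_vec n" for i x
  proof -
    have "sq_dist (embed (spread K m x)) (a i) =
        (\<Sum>j<n. \<Sum>p\<in>{j * K..<j * K + K}. (of_bool (x $ j) - a i $ p)\<^sup>2) + (\<Sum>p\<in>{n * K..<m}. (a i $ p)\<^sup>2)"
      using sq_dist_spread[of "a i" m x n K] x m' by (simp add: a_def)
    also have "(\<Sum>j<n. \<Sum>p\<in>{j * K..<j * K + K}. (of_bool (x $ j) - a i $ p)\<^sup>2) =
        (\<Sum>j<n. of_int (2 * (?l i j * of_bool (x $ j)) + int (r i j)))"
    proof (intro sum.cong refl)
      fix j assume "j \<in> {..<n}"
      then have j: "j < n" by simp
      have "a i $ (j * K + q) = of_bool (q < r i j)" if "q < K" for q
      proof -
        have "j * K + q < (j + 1) * K" using that by simp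
        also have "\<dots> \<le> n * K" using j by (intro mult_right_mono) auto
        finally show ?thesis using m' that by (simp add: a_def)
      qed
      then have "(\<Sum>p\<in>{j * K..<j * K + K}. (of_bool (x $ j) - a i $ p)\<^sup>2) =
          (\<Sum>q<K. (of_bool (x $ j) - of_bool (q < r i j))\<^sup>2)"
        unfolding sum_shift_block by (intro sum.cong) auto
      also have "\<dots> = of_int (2 * (?l i j * of_bool (x $ j)) + int (r i j))"
        using r[OF i j] by (simp add: sum_sq_diff_of_bool K_def)
      finally show "(\<Sum>p\<in>{j * K..<j * K + K}. (of_bool (x $ j) - a i $ p)\<^sup>2) =
        of_int (2 * (?l i j * of_bool (x $ j)) + int (r i j))" .
    qed
    also have "(\<Sum>p\<in>{n * K..<m}. (a i $ p)\<^sup>2) =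
        (\<Sum>p\<in>insert (n * K + W + i) {n * K..<n * K + w i}. 1)"
      using i m' w(2)[OF i] by (intro sum.mono_neutral_cong_right) (auto simp: a_def)
    also have "\<dots> = of_int (int (w i) + 1)" using w(2)[OF i] by simp
    finally show ?thesis
      unfolding w(1)[OF i] of_int_sum[symmetric] using carrier[of "G ! i"] i x
      by (simp add: eval_form_sum[where n = n] sum.distrib flip: sum_distrib_left
        del: sum_mult_of_bool_eq sum_of_bool_mult_eq of_int_sum)
  qed
  moreover have "a ` {..<length G} \<subseteq> hypercube m" by (auto simp: a_def hypercube_iff)
  ultimately show ?thesis
    unfolding K_def[symmetric] by (intro exI[of _ a] exI[of _ "2 :: real"] exI[of _ "of_int C + 1"]) simp
qed

section \<open>Gluing the dimensions into one family\<close>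

definition nn_class :: "(nat \<Rightarrow> real vec set) \<Rightarrow> bool_family set" where
  "nn_class H = {f. \<exists>s. poly_bounded s \<and>
     (\<forall>n. \<exists>k P N. knn_rep n k P N f \<and> P \<union> N \<subseteq> H n \<and> card (P \<union> N) \<le> s n)}"

lemma kNN_eq_nn_class: "kNN = nn_class carrier_vec"
proof -
  have "knn_rep n k P N f \<longleftrightarrow> knn_rep n k P N f \<and> P \<union> N \<subseteq> carrier_vec n" for n k P N f
    unfolding knn_rep_iff by blast
  then show ?thesis unfolding kNN_def nn_class_def by (metis (no_types, lifting))
qed

lemma kHNN_eq_nn_class: "kHNN = nn_class hypercube"
  unfolding kHNN_def nn_class_def by simp

text \<open>Strict monotonicity of \<open>M\<close> is what lets the functions for different \<open>n\<close> be glued into a single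
  family, and it gives \<open>n \<le> M n\<close>, so that bounds in \<open>n\<close> are bounds in the dimension.\<close>

lemma subfunction_nn_classI:
  assumes M: "strict_mono M" "poly_bounded M" and H: "\<And>n. H n \<subseteq> carrier_vec n"
    and rep: "\<And>n. \<exists>k P N v. finite P \<and> finite N \<and> P \<inter> N = {} \<and> P \<union> N \<subseteq> H (M n) \<and> k > 0 \<and>
      card (P \<union> N) \<le> poly p n \<and> substitution n (M n) v \<and>
      (\<forall>x \<in> carrier_vec n. f x \<longleftrightarrow> knn_value k P N (v x))"
  shows "f \<in> subfunctions (nn_class H)"
proof -
  from rep obtain k P N v where fin: "\<And>n. finite (P n)" "\<And>n. finite (N n)" and disj: "\<And>n. P n \<inter> N n = {}"
    and sub: "\<And>n. P n \<union> N n \<subseteq> H (M n)" and k: "\<And>n. k n > 0" and card: "\<And>n. card (P n \<union> N n) \<le> poly p n"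
    and v: "\<And>n. substitution n (M n) (v n)"
    and f: "\<And>n x. x \<in> carrier_vec n \<Longrightarrow> f x \<longleftrightarrow> knn_value (k n) (P n) (N n) (v n x)"
    by metis
  \<comment> \<open>The dimension of \<open>y\<close> determines \<open>n\<close>, because
    \<open>M\<close> is injective; in dimensions outside its range \<open>g\<close> is constantly
    false.\<close>
  define g :: bool_family where
    "g y \<longleftrightarrow> (\<exists>n. M n = dim_vec y \<and> knn_value (k n) (P n) (N n) y)" for y
  have inj: "M n = M n' \<longleftrightarrow> n = n'" for n n' using M(1) by (rule strict_mono_eq)
  have "\<exists>k P N. knn_rep m k P N g \<and> P \<union> N \<subseteq> H m \<and> card (P \<union> N) \<le> poly p m" for m
  proof (cases "\<exists>n. M n = m")
    case True
    then obtain n where n: "M n = m" by blast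
    have "g y \<longleftrightarrow> knn_value (k n) (P n) (N n) y" if "y \<in> carrier_vec m" for y
      using that unfolding g_def n[symmetric] by (auto simp: inj)
    \<comment> \<open>The size bound is known in terms of \<open>n\<close>, but membership of
      \<open>g\<close> requires one in terms of \<open>m = M n \<ge> n\<close>.\<close>
    moreover have "poly p n \<le> poly p m"
      using strict_mono_imp_increasing[OF M(1), of n] n by (intro poly_nat_mono) simp
    ultimately have "knn_rep m (k n) (P n) (N n) g \<and> P n \<union> N n \<subseteq> H m \<and> card (P n \<union> N n) \<le> poly p m"
      unfolding knn_rep_iff using fin disj k card[of n] sub[of n] H[of m] n by auto
    then show ?thesis by blast
  next
    case False
    then have "\<not> g y" if "y \<in> carrier_vec m" for y using that by (auto simp: g_def)
    \<comment> \<open>An empty anchor set has no subset of size 1, so it represents the constant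
      0.\<close>
    then have "knn_rep m 1 {} {} g" by (auto simp: knn_rep_iff knn_value_def)
    then show ?thesis by (intro exI[of _ 1] exI[of _ "{}"]) auto
  qed
  then have "g \<in> nn_class H" unfolding nn_class_def using poly_bounded_poly by blast
  moreover have "f x \<longleftrightarrow> g (v n x)" if "x \<in> carrier_vec n" for n x
  proof -
    have "v n x \<in> carrier_vec (M n)" using v[of n] that by (simp add: substitution_def)
    then show ?thesis unfolding g_def using f[OF that] by (auto simp: inj)
  qed
  ultimately show ?thesis
    unfolding subfunctions_def subfunction_def using M(2) v by blast
qed

text \<open>For \<open>kSTAT\<close> a separate bound for each \<open>n\<close> suffices: the
  dimension in \<open>real_anchors\<close> does not depend on the size of the coefficients.\<close>

lemma ex_coeffs_bound: "\<exists>c. \<forall>L \<in> set Ls. coeffs_bounded c L"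
proof (induction Ls)
  case (Cons L Ls)
  then obtain c where c: "\<forall>L \<in> set Ls. coeffs_bounded c L" by blast
  define d where "d = nat (\<bar>snd L\<bar> + (\<Sum>i<dim_vec (fst L). \<bar>fst L $ i\<bar>))"
  have nonneg: "0 \<le> (\<Sum>i<dim_vec (fst L). \<bar>fst L $ i\<bar>)" by (intro sum_nonneg) auto
  have "\<bar>fst L $ i\<bar> \<le> int d" if "i < dim_vec (fst L)" for i
    using member_le_sum[of i "{..<dim_vec (fst L)}" "\<lambda>i. \<bar>fst L $ i\<bar>"] that by (simp add: d_def)
  then have "coeffs_bounded d L" using nonneg by (simp add: coeffs_bounded_def d_def)
  then have "\<forall>L' \<in> set (L # Ls). coeffs_bounded (c + d) L'"
    using c coeffs_bounded_mono[of c _ "c + d"] coeffs_bounded_mono[of d L "c + d"] by auto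
  then show ?case by blast
qed simp

lemma kSTAT_subset: "kSTAT \<subseteq> subfunctions kNN"
proof
  fix f assume "f \<in> kSTAT"
  then obtain p :: "nat poly"
    where rep: "\<And>n. \<exists>Ls Rs kl kr. kstat_rep n Ls Rs kl kr f \<and> length Ls + length Rs \<le> poly p n"
    unfolding kSTAT_def poly_bounded_def by (blast intro: order_trans)
  \<comment> \<open>The \<open>n\<close> variables plus one private coordinate for each of at most
    \<open>2 * poly p n\<close> anchors. Using the monotone bound \<open>p\<close> instead of the
    actual size makes \<open>M\<close> strictly increasing.\<close>
  define M where "M n = n + 2 * poly p n" for n
  have "M n < M n'" if "n < n'" for n n'
    using that poly_nat_mono[of n n' p] by (simp add: M_def)
  then have M: "strict_mono M" by (rule strict_monoI)
  have "poly_bounded M" unfolding M_def by (intro poly_bounded_intros)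
  with M show "f \<in> subfunctions kNN"
    unfolding kNN_eq_nn_class
  proof (rule subfunction_nn_classI[where p = "[:2:] * p"])
    fix n
    obtain Ls Rs kl kr where Ls: "kstat_rep n Ls Rs kl kr f" "length Ls + length Rs \<le> poly p n"
      using rep by blast
    obtain c where c: "\<forall>L \<in> set Ls \<union> set Rs. coeffs_bounded c L"
      using ex_coeffs_bound[of "Ls @ Rs"] by auto
    have "\<exists>k P N. finite P \<and> finite N \<and> P \<inter> N = {} \<and> P \<union> N \<subseteq> carrier_vec (M n) \<and> k > 0 \<and>
        card (P \<union> N) \<le> 2 * poly p n \<and> (\<forall>x \<in> carrier_vec n. f x \<longleftrightarrow> knn_value k P N (spread 1 (M n) x))"
      by (rule kstat_rep_imp_knn_value[OF Ls(1) c Ls(2)], rule real_anchors) (auto simp: M_def)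
    then show "\<exists>k P N v. finite P \<and> finite N \<and> P \<inter> N = {} \<and> P \<union> N \<subseteq> carrier_vec (M n) \<and> k > 0 \<and>
        card (P \<union> N) \<le> poly ([:2:] * p) n \<and> substitution n (M n) v \<and>
        (\<forall>x \<in> carrier_vec n. f x \<longleftrightarrow> knn_value k P N (v x))"
      using substitution_spread[of n "M n" 1] by simp blast
  qed simp
qed

lemma kSTAT_poly_subset: "kSTAT_poly \<subseteq> subfunctions kHNN"
proof
  fix f assume "f \<in> kSTAT_poly"
  then obtain s c where s: "poly_bounded s" and c: "poly_bounded c"
    and rep: "\<And>n. \<exists>Ls Rs kl kr. kstat_rep n Ls Rs kl kr f \<and>
      length Ls + length Rs \<le> s n \<and> (\<forall>L \<in> set Ls \<union> set Rs. coeffs_bounded (c n) L)"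
    unfolding kSTAT_poly_def by blast
  from s obtain p where p: "\<And>n. s n \<le> poly p n" unfolding poly_bounded_def by blast
  from c obtain q where q: "\<And>n. c n \<le> poly q n" unfolding poly_bounded_def by blast
  \<comment> \<open>This is the coefficient bound after padding and perturbing, with
    \<open>S = poly p n\<close> and \<open>c = poly q n\<close>.\<close>
  define d where "d n = 2 * poly p n * ((n + 1) * poly q n) + 2 * poly p n" for n
  \<comment> \<open>The bracket is the dimension demanded by \<open>boolean_anchors\<close>; the
    leading \<open>n\<close> makes \<open>M\<close> strictly increasing.\<close>
  define M where "M n = n + (n * (2 * d n) + (4 * d n + 2 * d n * n) + 2 * poly p n)" for n
  have "M n < M n'" if "n < n'" for n n'
  proof -
    have "n \<le> n'" using that by simp
    then have le: "poly p n \<le> poly p n'" "poly q n \<le> poly q n'" by (simp_all add: poly_nat_mono)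
    then have "d n \<le> d n'"
      unfolding d_def using \<open>n \<le> n'\<close> by (intro add_mono mult_mono) auto
    then show ?thesis
      unfolding M_def using \<open>n \<le> n'\<close> le that by (intro add_less_le_mono add_mono mult_mono) auto
  qed
  then have M: "strict_mono M" by (rule strict_monoI)
  have "poly_bounded M" unfolding M_def d_def by (intro poly_bounded_intros)
  with M show "f \<in> subfunctions kHNN"
    unfolding kHNN_eq_nn_class
  proof (rule subfunction_nn_classI[where p = "[:2:] * p"])
    show "hypercube n \<subseteq> carrier_vec n" for n by (rule hypercube_carrier)
    fix n
    obtain Ls Rs kl kr where Ls: "kstat_rep n Ls Rs kl kr f" "length Ls + length Rs \<le> s n"
      "\<forall>L \<in> set Ls \<union> set Rs. coeffs_bounded (c n) L"
      using rep by blast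
    have len: "length Ls + length Rs \<le> poly p n" using Ls(2) p by (rule order_trans)
    have bounded: "\<forall>L \<in> set Ls \<union> set Rs. coeffs_bounded (poly q n) L"
      using Ls(3) q coeffs_bounded_mono by blast
    have "\<exists>k P N. finite P \<and> finite N \<and> P \<inter> N = {} \<and> P \<union> N \<subseteq> hypercube (M n) \<and> k > 0 \<and>
        card (P \<union> N) \<le> 2 * poly p n \<and> (\<forall>x \<in> carrier_vec n. f x \<longleftrightarrow> knn_value k P N (spread (2 * d n) (M n) x))"
      by (rule kstat_rep_imp_knn_value[OF Ls(1) bounded len], rule boolean_anchors, assumption)
        (simp_all only: d_def[symmetric], simp add: M_def)
    then show "\<exists>k P N v. finite P \<and> finite N \<and> P \<inter> N = {} \<and> P \<union> N \<subseteq> hypercube (M n) \<and> k > 0 \<and>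
        card (P \<union> N) \<le> poly ([:2:] * p) n \<and> substitution n (M n) v \<and>
        (\<forall>x \<in> carrier_vec n. f x \<longleftrightarrow> knn_value k P N (v x))"
      using substitution_spread[of n "M n" "2 * d n"] by simp blast
  qed
qed

theorem theorem4:
  shows "subfunctions kNN = kSTAT \<and> subfunctions kHNN = kSTAT_poly"
  using subfunctions_kNN_subset kSTAT_subset subfunctions_kHNN_subset kSTAT_poly_subset
  by (intro conjI equalityI)

end
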